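(* For every $\tau\in X$, the map $z\mapsto W_\tau v_z^{-1}$ is a bijection between $\widetilde Z_\tau$ and $W_\tau\backslash W$. In particular, for any $\tau\in X$, one has $|\widetilde Z_\tau|=n_\tau$.
   Context: $\mathfrak g$ is a finite-dimensional complex simple Lie algebra with Cartan subalgebra $\mathfrak h$, root system $\Delta$, positive roots $\Delta^+$, simple roots $\Pi=\{\alpha_1,\dots,\alpha_n\}$, highest root $\theta$, Weyl group $W$. $\mathfrak h_{\mathbb R}$ is the real span of the coroots, identified with its dual via the Killing form, $(\cdot,\cdot)$ the form/pairing; $P^\vee$ is the coweight lattice. $X=\{x\in P^\vee\mid(x,\alpha_i)\ge0\ \forall i,\ (x,\theta)\le2\}$. For $\tau\in X$, $\mathfrak k_\tau$ is the fixed subalgebra of the involution $\Theta_\tau=Ad(\exp(\sqrt{-1}\,\pi\tau))$ of $\mathfrak g$ (its roots are the $\alpha\in\Delta$ with $(\alpha,\tau)$ even), $W_\tau\subset W$ is the Weyl group of $(\mathfrak k_\tau,\mathfrak h)$, and $n_\tau=[W:W_\tau]$. For $w\in W$, $N(w)=\{\alpha\in\Delta^+\mid w^{-1}(\alpha)<0\}$. For $z\in\mathfrak h_{\mathbb R}$, $v_z$ is the unique element of $W$ with $N(v_z)=\{\alpha\in\Delta^+\mid(\alpha,z)<0\}$; then $v_z^{-1}(z)$ is dominant and one sets $dom(z)=v_z^{-1}(z)$. $\widetilde Z_{ab}=\{\sigma\in P^\vee\mid(\sigma,\beta)\in\{0,-1,1,-2\}\ \forall\beta\in\Delta^+\}$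 and $\widetilde Z_\tau=\{z\in\widetilde Z_{ab}\mid dom(z)=\tau\}$. *)

theory Defs
  imports
    Complex_Main
    "HOL-Algebra.Bij"
    "HOL-Algebra.Coset"
    "HOL-Algebra.Generated_Groups"
begin

section \<open>Complex Lie algebras\<close>

locale complex_lie_algebra = vector_space scale
  for scale :: "complex \<Rightarrow> 'g::ab_group_add \<Rightarrow> 'g"  (infixr \<open>*c\<close> 75)
  and br :: "'g \<Rightarrow> 'g \<Rightarrow> 'g" +
  assumes br_add_left: "br (x + y) z = br x z + br y z"
    and br_add_right: "br x (y + z) = br x y + br x z"
    and br_scale_left: "br (c *c x) y = c *c br x y"
    and br_scale_right: "br x (c *c y) = c *c br x y"
    and br_self: "br x x = 0"
    and jacobi: "br x (br y z) + br y (br z x) + br z (br x y) = 0"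
begin

definition finite_dim :: bool where
  "finite_dim \<longleftrightarrow> (\<exists>B. finite B \<and> span B = UNIV)"

definition ideal :: "'g set \<Rightarrow> bool" where
  "ideal I \<longleftrightarrow> subspace I \<and> (\<forall>x. \<forall>y\<in>I. br x y \<in> I)"

definition simple :: bool where
  "simple \<longleftrightarrow> (\<exists>x y. br x y \<noteq> 0) \<and> (\<forall>I. ideal I \<longrightarrow> I = {0} \<or> I = UNIV)"

text \<open>
  The basis \<^term>\<open>extend_basis {}\<close> is an arbitrary basis of the whole space; trace and exponential
  of an endomorphism do not depend on it in the finite-dimensional case.
\<close>

definition trace_op :: "('g \<Rightarrow> 'g) \<Rightarrow> complex" where
  "trace_op f = (\<Sum>b\<in>extend_basis {}. representation (extend_basis {}) (f b) b)"

text \<open>The exponential series of an endomorphism, summed coordinatewise.\<close>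

definition exp_op :: "('g \<Rightarrow> 'g) \<Rightarrow> 'g \<Rightarrow> 'g" where
  "exp_op f v =
     (\<Sum>b\<in>extend_basis {}. (\<Sum>n. representation (extend_basis {}) ((f ^^ n) v) b / fact n) *c b)"

definition killing :: "'g \<Rightarrow> 'g \<Rightarrow> complex" where
  "killing x y = trace_op (\<lambda>z. br x (br y z))"

definition abelian_subalgebra :: "'g set \<Rightarrow> bool" where
  "abelian_subalgebra H \<longleftrightarrow> subspace H \<and> (\<forall>x\<in>H. \<forall>y\<in>H. br x y = 0)"

text \<open>
  Cartan subalgebras of a semisimple complex Lie algebra: maximal abelian subalgebras all of whose
  elements are ad-semisimple, i.e. (over the complex numbers) ad-diagonalizable.
\<close>

definition cartan_subalgebra :: "'g set \<Rightarrow> bool" where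
  "cartan_subalgebra H \<longleftrightarrow>
     abelian_subalgebra H \<and>
     (\<forall>H'. abelian_subalgebra H' \<and> H \<subseteq> H' \<longrightarrow> H' = H) \<and>
     (\<forall>x\<in>H. span {v. \<exists>c. br x v = c *c v} = UNIV)"

end

section \<open>Roots and Weyl groups relative to a Cartan subalgebra\<close>

text \<open>
  Functionals on \<open>h\<close> and elements of Weyl groups are represented by functions
  that are \<^const>\<open>extensional\<close> on \<open>h\<close>.
\<close>

locale lie_algebra_with_cartan = complex_lie_algebra scale br
  for scale :: "complex \<Rightarrow> 'g::ab_group_add \<Rightarrow> 'g"  (infixr \<open>*c\<close> 75)
  and br :: "'g \<Rightarrow> 'g \<Rightarrow> 'g" +
  fixes h :: "'g set"
begin

text \<open>
  The nonzero weights of \<open>h\<close> on a subspace \<open>k\<close> (linearity on \<open>h\<close> follows from the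
  weight condition). For \<open>k = UNIV\<close> these are the roots of the Lie algebra itself.
\<close>

definition roots_in :: "'g set \<Rightarrow> ('g \<Rightarrow> complex) set" where
  "roots_in k = {\<alpha> \<in> extensional h.
     (\<exists>x\<in>h. \<alpha> x \<noteq> 0) \<and> (\<exists>v\<in>k. v \<noteq> 0 \<and> (\<forall>x\<in>h. br x v = \<alpha> x *c v))}"

definition roots :: "('g \<Rightarrow> complex) set" where
  "roots = roots_in UNIV"

definition neg_root :: "('g \<Rightarrow> complex) \<Rightarrow> 'g \<Rightarrow> complex" where
  "neg_root \<alpha> = (\<lambda>x\<in>h. - \<alpha> x)"

text \<open>The element of \<open>h\<close> corresponding to a functional under the Killing form.\<close>

definition killing_dual :: "('g \<Rightarrow> complex) \<Rightarrow> 'g" where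
  "killing_dual \<alpha> = (THE t. t \<in> h \<and> (\<forall>x\<in>h. killing t x = \<alpha> x))"

definition coroot :: "('g \<Rightarrow> complex) \<Rightarrow> 'g" where
  "coroot \<alpha> = (2 / \<alpha> (killing_dual \<alpha>)) *c killing_dual \<alpha>"

definition reflection :: "('g \<Rightarrow> complex) \<Rightarrow> 'g \<Rightarrow> 'g" where
  "reflection \<alpha> = (\<lambda>x\<in>h. x - \<alpha> x *c coroot \<alpha>)"

text \<open>
  The Weyl group of \<open>(k, h)\<close> for a subalgebra \<open>k\<close> containing \<open>h\<close>, as a set of bijections of \<open>h\<close>.
\<close>

definition weyl_of :: "'g set \<Rightarrow> ('g \<Rightarrow> 'g) set" where
  "weyl_of k = generate (BijGroup h) (reflection ` roots_in k)"

definition weyl_group :: "('g \<Rightarrow> 'g) monoid" where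
  "weyl_group = BijGroup h \<lparr>carrier := weyl_of UNIV\<rparr>"

text \<open>The action on functionals, \<open>(w \<alpha>)(x) = \<alpha>(w\<^sup>-\<^sup>1 x)\<close>.\<close>

definition act :: "('g \<Rightarrow> 'g) \<Rightarrow> ('g \<Rightarrow> complex) \<Rightarrow> 'g \<Rightarrow> complex" where
  "act w \<alpha> = (\<lambda>x\<in>h. \<alpha> ((inv\<^bsub>weyl_group\<^esub> w) x))"

definition h_real :: "'g set" where
  "h_real = module.span (\<lambda>r::real. scale (complex_of_real r)) (coroot ` roots)"

text \<open>Roots take real values on \<^term>\<open>h_real\<close>, so nothing is lost by taking the real part.\<close>

definition pairing :: "'g \<Rightarrow> ('g \<Rightarrow> complex) \<Rightarrow> real" where
  "pairing x \<alpha> = Re (\<alpha> x)"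

definition coweight_lattice :: "'g set" where
  "coweight_lattice = {x \<in> h_real. \<forall>\<alpha>\<in>roots. pairing x \<alpha> \<in> \<int>}"

definition nonneg_comb :: "('g \<Rightarrow> complex) set \<Rightarrow> ('g \<Rightarrow> complex) \<Rightarrow> bool" where
  "nonneg_comb B \<phi> \<longleftrightarrow>
     (\<exists>c :: ('g \<Rightarrow> complex) \<Rightarrow> nat. \<forall>x\<in>h. \<phi> x = (\<Sum>\<beta>\<in>B. of_nat (c \<beta>) * \<beta> x))"

definition simple_system :: "('g \<Rightarrow> complex) set \<Rightarrow> bool" where
  "simple_system B \<longleftrightarrow>
     finite B \<and> B \<subseteq> roots \<and>
     (\<forall>c :: ('g \<Rightarrow> complex) \<Rightarrow> complex.
        (\<forall>x\<in>h. (\<Sum>\<beta>\<in>B. c \<beta> * \<beta> x) = 0) \<longrightarrow> (\<forall>\<beta>\<in>B. c \<beta> = 0)) \<and>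
     (\<forall>\<alpha>\<in>roots. nonneg_comb B \<alpha> \<or> nonneg_comb B (neg_root \<alpha>))"

definition highest_root :: "('g \<Rightarrow> complex) set \<Rightarrow> ('g \<Rightarrow> complex) \<Rightarrow> bool" where
  "highest_root B \<theta> \<longleftrightarrow>
     \<theta> \<in> roots \<and> (\<forall>\<beta>\<in>roots. nonneg_comb B (\<lambda>x. \<theta> x - \<beta> x))"

text \<open>
  \<open>Ad (exp (\<i> \<pi> \<tau>)) = exp (ad (\<i> \<pi> \<tau>))\<close>, and its fixed subalgebra.
\<close>

definition Theta :: "'g \<Rightarrow> 'g \<Rightarrow> 'g" where
  "Theta \<tau> = exp_op (br ((\<i> * complex_of_real pi) *c \<tau>))"

definition k_tau :: "'g \<Rightarrow> 'g set" where
  "k_tau \<tau> = {x. Theta \<tau> x = x}"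

definition W_tau :: "'g \<Rightarrow> ('g \<Rightarrow> 'g) set" where
  "W_tau \<tau> = weyl_of (k_tau \<tau>)"

definition n_tau :: "'g \<Rightarrow> nat" where
  "n_tau \<tau> = card (rcosets\<^bsub>weyl_group\<^esub> (W_tau \<tau>))"

end

section \<open>Simple Lie algebras with a fixed simple system\<close>

locale simple_lie_algebra_setup = lie_algebra_with_cartan scale br h
  for scale :: "complex \<Rightarrow> 'g::ab_group_add \<Rightarrow> 'g"  (infixr \<open>*c\<close> 75)
  and br :: "'g \<Rightarrow> 'g \<Rightarrow> 'g"
  and h :: "'g set" +
  fixes simples :: "('g \<Rightarrow> complex) set"
    and \<theta> :: "'g \<Rightarrow> complex"
  assumes finite_dim: "finite_dim"
    and simple: "simple"
    and cartan: "cartan_subalgebra h"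
    and simple_system: "simple_system simples"
    and highest_root: "highest_root simples \<theta>"
begin

definition pos_roots :: "('g \<Rightarrow> complex) set" where
  "pos_roots = {\<alpha> \<in> roots. nonneg_comb simples \<alpha>}"

definition neg_roots :: "('g \<Rightarrow> complex) set" where
  "neg_roots = neg_root ` pos_roots"

definition X :: "'g set" where
  "X = {x \<in> coweight_lattice. (\<forall>\<alpha>\<in>simples. pairing x \<alpha> \<ge> 0) \<and> pairing x \<theta> \<le> 2}"

definition N :: "('g \<Rightarrow> 'g) \<Rightarrow> ('g \<Rightarrow> complex) set" where
  "N w = {\<alpha> \<in> pos_roots. act (inv\<^bsub>weyl_group\<^esub> w) \<alpha> \<in> neg_roots}"

definition v :: "'g \<Rightarrow> 'g \<Rightarrow> 'g" where
  "v z = (THE w. w \<in> carrier weyl_group \<and> N w = {\<alpha> \<in> pos_roots. pairing z \<alpha> < 0})"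

definition dominant_rep :: "'g \<Rightarrow> 'g" where
  "dominant_rep z = (inv\<^bsub>weyl_group\<^esub> (v z)) z"

definition Z_ab :: "'g set" where
  "Z_ab = {\<sigma> \<in> coweight_lattice. \<forall>\<beta>\<in>pos_roots. pairing \<sigma> \<beta> \<in> {0, -1, 1, -2}}"

definition Z_tau :: "'g \<Rightarrow> 'g set" where
  "Z_tau \<tau> = {z \<in> Z_ab. dominant_rep z = \<tau>}"

end

end

theory Submission
  imports Defs
begin

text \<open>
  An element \<open>z\<close> of \<open>Z_tau \<tau>\<close> is \<open>w \<tau>\<close> with \<open>w = v z\<close>, and the conditions on \<open>z\<close> say that \<open>w\<close>
  maps to positive roots a certain positive system of the roots even on \<open>\<tau>\<close>: the positive roots
  orthogonal to \<open>\<tau>\<close> and the roots with value \<open>-2\<close> on \<open>\<tau>\<close>. The even roots form the root system of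
  \<open>k_tau \<tau>\<close>, and \<open>W_tau \<tau>\<close> acts simply transitively on its positive systems, so every coset
  contains exactly one inverse of such a \<open>w\<close>.

  The root system of the Lie algebra is obtained without Cartan's criterion and without the
  representation theory of \<open>sl\<^sub>2\<close>. On a subspace stable under \<open>ad e\<close> and \<open>ad f\<close> the trace of
  \<open>ad [e, f]\<close> vanishes; applied to root strings, pieces of root strings and
  \<open>span {f} + h + \<Sum>\<^sub>k g\<^sub>k\<^sub>\<alpha>\<close> this gives nondegeneracy of the Killing form, unbroken strings,
  integrality, and one-dimensional root spaces.
\<close>

section \<open>Reflections and positive systems\<close>

text \<open>Since \<open>\<tau>\<close> is dominant and at most 2 on the highest root, every root
  takes a value between -2 and 2 on \<open>\<tau>\<close>, hence also on
  \<open>z = w \<tau>\<close>. Membership in \<open>Z_ab\<close> therefore only forbids a positive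
  root the value 2, which says that \<open>w\<close> makes the roots with value -2 on
  \<open>\<tau>\<close> positive. The condition \<open>w = v z\<close> matters only at ties: for a
  nonzero value the sign of \<open>w\<^sup>-\<^sup>1 \<beta>\<close> is forced by dominance, and for
  the value 0 the condition says that \<open>w\<close> keeps positive the positive roots orthogonal
  to \<open>\<tau>\<close>. Odd values impose nothing, so everything is decided by the even roots.
  The even roots come without a simple system. A positive system is therefore encoded by a real
  linear functional that is nonzero on all roots, and one abstract argument serves both the full
  root system and the even one. Simple transitivity is used twice: in the full group for existence
  and uniqueness of \<open>v z\<close>, and in \<open>W_tau \<tau>\<close> for the cosets.\<close>

definition real_linear :: "(complex \<Rightarrow> 'g::ab_group_add \<Rightarrow> 'g) \<Rightarrow> ('g \<Rightarrow> real) \<Rightarrow> bool" where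
  "real_linear scale f \<longleftrightarrow>
     (\<forall>x y. f (x + y) = f x + f y) \<and> (\<forall>r x. f (scale (complex_of_real r) x) = r * f x)"

locale symmetric_form = vector_space scale
  for scale :: "complex \<Rightarrow> 'g::ab_group_add \<Rightarrow> 'g"  (infixr \<open>*c\<close> 75) +
  fixes K :: "'g \<Rightarrow> 'g \<Rightarrow> complex"
  assumes K_add: "K (x + y) z = K x z + K y z"
    and K_scale: "K (c *c x) y = c * K x y"
    and K_sym: "K x y = K y x"
begin

lemma K_add_right: "K z (x + y) = K z x + K z y"
  by (metis K_add K_sym)

lemma K_scale_right: "K x (c *c y) = c * K x y"
  by (metis K_scale K_sym)

lemma K_0 [simp]: "K 0 y = 0" "K y 0 = 0"
  using K_scale[of 0 0 y] K_sym[of y 0] by simp_all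

lemma K_minus: "K (- x) y = - K x y" "K y (- x) = - K y x"
  using K_add[of x "- x" y] K_sym[of y] by (simp_all add: eq_neg_iff_add_eq_0 add.commute)

lemma K_diff: "K (x - y) z = K x z - K y z" "K z (x - y) = K z x - K z y"
  using K_add[of x "- y" z] K_add_right[of z x "- y"] by (simp_all add: K_minus)

text \<open>The Cartan number of \<open>b\<close> against the coroot of \<open>a\<close>; it is
  linear in the first argument only.\<close>

definition cart :: "'g \<Rightarrow> 'g \<Rightarrow> complex" where
  "cart b a = 2 * K a b / K a a"

definition refl :: "'g \<Rightarrow> 'g \<Rightarrow> 'g" where
  "refl a x = x - cart x a *c a"

text \<open>Weyl group elements are handled as words in roots: reversal gives the inverse, and
  induction on the length is available. The head of the list acts last.\<close>

primrec refls :: "'g list \<Rightarrow> 'g \<Rightarrow> 'g" where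
  "refls [] x = x"
| "refls (a # as) x = refl a (refls as x)"

lemma refls_append: "refls (as @ bs) x = refls as (refls bs x)"
  by (induction as) auto

lemma refl_add: "refl a (x + y) = refl a x + refl a y"
  by (simp add: refl_def cart_def K_add_right distrib_left add_divide_distrib scale_left_distrib)

lemma refl_scale: "refl a (c *c x) = c *c refl a x"
  by (simp add: refl_def cart_def K_scale_right scale_right_diff_distrib)

lemma refl_minus: "refl a (- x) = - refl a x"
  using refl_scale[of a "-1" x] by simp

lemma refl_self: "K a a \<noteq> 0 \<Longrightarrow> refl a a = - a"
  using scale_left_diff_distrib[of 1 2 a] by (simp add: refl_def cart_def)

lemma refl_neg: "refl (- a) = refl a"
  by (rule ext) (simp add: refl_def cart_def K_minus)

lemma refl_refl: "K a a \<noteq> 0 \<Longrightarrow> refl a (refl a x) = x"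
  using refl_add[of a x "- (cart x a *c a)"]
  by (simp add: refl_minus refl_scale refl_self) (simp add: refl_def)

lemma K_refl: "K a a \<noteq> 0 \<Longrightarrow> K (refl a x) (refl a y) = K x y"
  by (simp add: refl_def cart_def K_diff K_scale K_scale_right K_sym[of x a] field_simps)

text \<open>The reflection in \<open>a\<close> is an isometry and so preserves Cartan numbers; this
  is the conjugation rule for reflections.\<close>

lemma refl_conj:
  assumes "K a a \<noteq> 0"
  shows "refl (refl a b) (refl a x) = refl a (refl b x)"
proof -
  have "refl a (refl b x) = refl a x - cart x b *c refl a b"
    using refl_add[of a x "- (cart x b *c b)"]
    by (simp add: refl_def[of b] refl_minus refl_scale)
  then show ?thesis
    using assms by (simp add: refl_def[of "refl a b"] cart_def K_refl)
qed

lemma refls_add: "refls as (x + y) = refls as x + refls as y"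
  by (induction as) (auto simp: refl_add)

lemma refls_scale: "refls as (c *c x) = c *c refls as x"
  by (induction as) (auto simp: refl_scale)

lemma refls_minus: "refls as (- x) = - refls as x"
  by (induction as) (auto simp: refl_minus)

lemma K_refls: "(\<And>a. a \<in> set as \<Longrightarrow> K a a \<noteq> 0) \<Longrightarrow> K (refls as x) (refls as y) = K x y"
  by (induction as) (auto simp: K_refl)

lemma refls_rev: "(\<And>a. a \<in> set as \<Longrightarrow> K a a \<noteq> 0) \<Longrightarrow> refls (rev as) (refls as x) = x"
  by (induction as arbitrary: x) (auto simp: refls_append refl_refl)

lemma refls_conj:
  assumes "\<And>a. a \<in> set as \<Longrightarrow> K a a \<noteq> 0"
  shows "refl (refls as b) (refls as x) = refls as (refl b x)"
  using assms by (induction as) (auto simp: refl_conj)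

lemma real_linear_refls: "real_linear scale f \<Longrightarrow> real_linear scale (\<lambda>x. f (refls as x))"
  by (simp add: real_linear_def refls_add refls_scale)

end

text \<open>Of each root string only the segment from \<open>b\<close> down to
  \<open>refl a b\<close> enters the axioms. The case \<open>b = a\<close> is excluded in
  \<open>string\<close> because there the segment from \<open>a\<close> to \<open>- a\<close> passes
  through 0.\<close>

locale root_system = symmetric_form scale K
  for scale :: "complex \<Rightarrow> 'g::ab_group_add \<Rightarrow> 'g"  (infixr \<open>*c\<close> 75)
  and K :: "'g \<Rightarrow> 'g \<Rightarrow> complex" +
  fixes R :: "'g set"
  assumes finite_R: "finite R"
    and K_pos: "a \<in> R \<Longrightarrow> \<exists>r>0. K a a = complex_of_real r"
    and cart_int: "a \<in> R \<Longrightarrow> b \<in> R \<Longrightarrow> \<exists>n::int. cart b a = of_int n"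
    and refl_R: "a \<in> R \<Longrightarrow> b \<in> R \<Longrightarrow> refl a b \<in> R"
    and string: "\<lbrakk>a \<in> R; b \<in> R; b \<noteq> a; cart b a = of_nat n; k \<le> n\<rbrakk> \<Longrightarrow> b - of_nat k *c a \<in> R"
begin

lemma K_nz: "a \<in> R \<Longrightarrow> K a a \<noteq> 0"
  using K_pos by fastforce

lemma neg_R: "a \<in> R \<Longrightarrow> - a \<in> R"
  using refl_R[of a a] by (simp add: refl_self K_nz)

lemma refls_R: "set as \<subseteq> R \<Longrightarrow> b \<in> R \<Longrightarrow> refls as b \<in> R"
  by (induction as) (auto simp: refl_R)

text \<open>Multiplied by the positive norms of the two roots, both Cartan numbers become
  \<open>2 * K a b\<close>.\<close>

lemma cart_pos_sym:
  assumes "a \<in> R" "b \<in> R" and "cart b a = of_int m" "cart a b = of_int n"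
  shows "m > 0 \<longleftrightarrow> n > 0"
proof -
  obtain r s where rs: "r > 0" "s > 0" "K a a = of_real r" "K b b = of_real s"
    using K_pos assms(1,2) by metis
  have "complex_of_real (of_int m * r) = of_real (of_int n * s)"
    using assms(3,4) rs K_sym[of a b] by (simp add: cart_def field_simps)
  then have "of_int m * r = of_int n * s"
    using of_real_eq_iff by blast
  then show ?thesis
    using rs by (metis of_int_0_less_iff zero_less_mult_pos2 mult_pos_pos)
qed

text \<open>A regular functional, standing for the positive system of roots on which it is positive.
  Precomposition with a word moves the system, and restriction to a subsystem is immediate.\<close>

definition height :: "('g \<Rightarrow> real) \<Rightarrow> bool" where
  "height f \<longleftrightarrow> real_linear scale f \<and> (\<forall>a\<in>R. f a \<noteq> 0)"

lemma height_refls: "height f \<Longrightarrow> set as \<subseteq> R \<Longrightarrow> height (\<lambda>x. f (refls as x))"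
  by (simp add: height_def real_linear_refls refls_R)

end

section \<open>Simple roots of a positive system and the exchange condition\<close>

locale root_system_height = root_system scale K R
  for scale :: "complex \<Rightarrow> 'g::ab_group_add \<Rightarrow> 'g"  (infixr \<open>*c\<close> 75)
  and K :: "'g \<Rightarrow> 'g \<Rightarrow> complex" and R :: "'g set" +
  fixes f :: "'g \<Rightarrow> real"
  assumes height_f: "height f"
begin

lemma f_add: "f (x + y) = f x + f y"
  using height_f by (simp add: height_def real_linear_def)

lemma f_scale: "f (of_real r *c x) = r * f x"
  using height_f by (simp add: height_def real_linear_def)

lemma f_scale_int: "f (of_int n *c x) = of_int n * f x"
  using f_scale[of "of_int n" x] by simp

lemma f_minus: "f (- x) = - f x"
  using f_scale[of "-1" x] by simp

lemma f_diff: "f (x - y) = f x - f y"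
  using f_add[of x "- y"] by (simp add: f_minus)

lemma f_nz: "a \<in> R \<Longrightarrow> f a \<noteq> 0"
  using height_f by (simp add: height_def)

text \<open>The simple roots of the positive system cut out by \<open>f\<close>.\<close>

definition indec :: "'g set" where
  "indec = {a \<in> R. f a > 0 \<and> \<not> (\<exists>b\<in>R. \<exists>c\<in>R. f b > 0 \<and> f c > 0 \<and> a = b + c)}"

lemma indec_R: "indec \<subseteq> R"
  by (auto simp: indec_def)

text \<open>
  If \<open>refl a b\<close> were negative, the string \<open>b, b - a, \<dots>, refl a b\<close> would change sign
  between two consecutive roots, whose difference is \<open>a\<close>.
\<close>

lemma refl_indec_pos:
  assumes a: "a \<in> indec" and b: "b \<in> R" "f b > 0" "b \<noteq> a"
  shows "f (refl a b) > 0"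
proof -
  have aR: "a \<in> R" "f a > 0"
    using a by (auto simp: indec_def)
  obtain n where n: "cart b a = of_int n"
    using cart_int aR b by blast
  show ?thesis
  proof (cases "n \<le> 0")
    case True
    then have "real_of_int n * f a \<le> 0"
      using aR by (simp add: mult_le_0_iff)
    then show ?thesis
      using b by (simp add: refl_def n f_diff f_scale_int)
  next
    case False
    then obtain m where m: "n = int m"
      by (metis int_ops(1) less_imp_le linorder_not_less nonneg_int_cases)
    have R: "b - of_nat k *c a \<in> R" if "k \<le> m" for k
      using string[OF aR(1) b(1,3) _ that] n m by simp
    have "f (b - of_nat k *c a) > 0" if "k \<le> m" for k
      using that
    proof (induction k)
      case 0
      then show ?case using b by simp
    next
      case (Suc k)
      let ?c = "b - of_nat k *c a" and ?d = "b - of_nat (Suc k) *c a"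
      have "f ?c > 0" "?c \<in> R" "?d \<in> R"
        using Suc R[of k] R[OF Suc.prems] by (simp_all del: of_nat_Suc)
      moreover have "a = ?c + (- ?d)"
        by (simp add: algebra_simps)
      ultimately show ?case
        using a neg_R[of ?d] f_minus[of ?d] f_nz[of ?d] unfolding indec_def by force
    qed
    from this[of m] show ?thesis
      by (simp add: refl_def n m)
  qed
qed

text \<open>Both summands of a decomposable positive root have smaller \<open>f\<close>. As
  \<open>f\<close> is real valued, the well-founded measure is the number of roots lying
  below.\<close>

lemma pos_induct [consumes 2, case_names indec add]:
  assumes "a \<in> R" "f a > 0"
    and "\<And>a. a \<in> indec \<Longrightarrow> P a"
    and "\<And>b c. \<lbrakk>b \<in> R; f b > 0; c \<in> R; f c > 0; b + c \<in> R; P b; P c\<rbrakk> \<Longrightarrow> P (b + c)"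
  shows "P a"
  using assms(1,2)
proof (induction "card {b \<in> R. f b < f a}" arbitrary: a rule: less_induct)
  case less
  show ?case
  proof (cases "a \<in> indec")
    case False
    then obtain b c where bc: "b \<in> R" "c \<in> R" "f b > 0" "f c > 0" "a = b + c"
      using less.prems by (auto simp: indec_def)
    have "card {x \<in> R. f x < f d} < card {x \<in> R. f x < f a}" if "d \<in> R" "f d < f a" for d
      using finite_R that by (intro psubset_card_mono) auto
    then show ?thesis
      using bc less.hyps less.prems assms(4) f_add by simp
  qed (use assms in auto)
qed

text \<open>Otherwise \<open>b\<close> would have nonpositive inner product with all simple roots,
  hence with all positive roots, including itself. The additive quantity is \<open>cart a b\<close>
  as a function of \<open>a\<close>, so the sign assumption on \<open>cart b a\<close> is first
  transferred by \<open>cart_pos_sym\<close>.\<close>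

lemma exists_indec_cart_pos:
  assumes b: "b \<in> R" "f b > 0"
  shows "\<exists>a\<in>indec. \<exists>n>0. cart b a = of_int n"
proof (rule ccontr)
  assume neg: "\<not> ?thesis"
  have "Re (cart a b) \<le> 0" if "a \<in> R" "f a > 0" for a
    using that
  proof (induction rule: pos_induct)
    case (indec a)
    then have "a \<in> R"
      using indec_R by auto
    then obtain m n where "cart a b = of_int m" "cart b a = of_int n"
      using cart_int b by metis
    then show ?case
      using cart_pos_sym[of a b n m] neg indec \<open>a \<in> R\<close> b by force
  next
    case (add c d)
    then show ?case
      by (simp add: cart_def K_add_right distrib_left add_divide_distrib)
  qed
  then have "Re (cart b b) \<le> 0"
    using b by blast
  then show False
    using K_nz b by (simp add: cart_def)
qed

text \<open>A simple root \<open>a\<close> with positive Cartan number lowers a non-simple positive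
  \<open>b\<close> to a positive root \<open>refl a b\<close>, and the reflection in
  \<open>b\<close> is the conjugate by \<open>a\<close> of the reflection in that lower
  root.\<close>

lemma refl_eq_refls_indec:
  assumes "b \<in> R"
  shows "\<exists>as. set as \<subseteq> indec \<and> refl b = refls as"
proof -
  have pos: "\<exists>as. set as \<subseteq> indec \<and> refl b = refls as" if "b \<in> R" "f b > 0" for b
    using that
  proof (induction "card {x \<in> R. f x < f b}" arbitrary: b rule: less_induct)
    case less
    show ?case
    proof (cases "b \<in> indec")
      case True
      then show ?thesis
        by (intro exI[of _ "[b]"]) auto
    next
      case False
      obtain a n where a: "a \<in> indec" "n > 0" "cart b a = of_int n"
        using exists_indec_cart_pos less.prems by metis
      then have aR: "a \<in> R" "f a > 0"
        by (auto simp: indec_def)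
      let ?c = "refl a b"
      have c: "?c \<in> R" "f ?c > 0"
        using refl_indec_pos[of a b] refl_R a aR less.prems False by auto
      have "f ?c < f b"
        using a aR by (simp add: refl_def f_diff f_scale_int)
      then have "card {x \<in> R. f x < f ?c} < card {x \<in> R. f x < f b}"
        using finite_R c by (intro psubset_card_mono) auto
      from less.hyps[OF this c] obtain as where as: "set as \<subseteq> indec" "refl ?c = refls as"
        by auto
      have "refl b x = refls (a # as @ [a]) x" for x
      proof -
        have "refl b x = refl (refl a ?c) (refl a (refl a x))"
          by (simp only: refl_refl[OF K_nz[OF aR(1)]])
        also have "\<dots> = refl a (refl ?c (refl a x))"
          by (rule refl_conj[OF K_nz[OF aR(1)]])
        finally show ?thesis
          unfolding as(2) by (simp add: refls_append)
      qed
      then show ?thesis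
        using as a by (intro exI[of _ "a # as @ [a]"]) auto
    qed
  qed
  have "f b > 0 \<or> f (- b) > 0"
    using f_nz[OF assms] f_minus by auto
  then show ?thesis
    using pos[of b] pos[of "- b"] assms neg_R[OF assms] refl_neg[of b] by auto
qed

lemma refls_eq_refls_indec: "set bs \<subseteq> R \<Longrightarrow> \<exists>as. set as \<subseteq> indec \<and> refls bs = refls as"
proof (induction bs)
  case Nil
  then show ?case by (intro exI[of _ "[]"]) auto
next
  case (Cons b bs)
  then obtain as cs where "set as \<subseteq> indec" "refls bs = refls as" "set cs \<subseteq> indec" "refl b = refls cs"
    using refl_eq_refls_indec by (metis insert_subset list.simps(15))
  then show ?case
    by (intro exI[of _ "cs @ as"]) (auto simp: refls_append)
qed

text \<open>On the way through the word the positive root \<open>a\<close> becomes negative at some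
  letter \<open>c\<close>. A simple reflection makes only its own root negative, so the letters to
  the right of \<open>c\<close> send \<open>a\<close> to \<open>c\<close>; by conjugation the letter
  \<open>c\<close> cancels against the reflection in \<open>a\<close>.\<close>

lemma exchange:
  assumes "set as \<subseteq> indec" "a \<in> indec" "f (refls as a) < 0"
  shows "\<exists>bs. set bs \<subseteq> indec \<and> length bs < length as \<and> (\<forall>x. refls as (refl a x) = refls bs x)"
  using assms
proof (induction as)
  case Nil
  then show ?case by (auto simp: indec_def)
next
  case (Cons c cs)
  then have sub: "set cs \<subseteq> R" "a \<in> R" "c \<in> R" "c \<in> indec" "set cs \<subseteq> indec"
    using indec_R by auto
  let ?d = "refls cs a"
  have d: "?d \<in> R"
    using sub refls_R by auto
  show ?case
  proof (cases "f ?d < 0")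
    case True
    then obtain bs where "set bs \<subseteq> indec" "length bs < length cs" "\<forall>x. refls cs (refl a x) = refls bs x"
      using Cons sub by blast
    then show ?thesis
      using sub by (intro exI[of _ "c # bs"]) auto
  next
    case False
    then have "?d = c"
      using refl_indec_pos[of c ?d] d f_nz[OF d] sub Cons.prems by force
    then have "refl c (refls cs (refl a x)) = refls cs x" for x
      using refls_conj[of cs a "refl a x"] sub K_nz refl_refl by (metis subsetD)
    then show ?thesis
      using sub by (intro exI[of _ cs]) auto
  qed
qed

text \<open>If the word in simple roots is nonempty with last letter \<open>a\<close>, positivity of
  the image of \<open>a\<close> makes the remaining letters send \<open>a\<close> to a negative
  root. The exchange condition then gives a shorter word for the same map.\<close>

theorem refls_pos_imp_id:
  assumes "set as \<subseteq> R" and "\<And>a. a \<in> R \<Longrightarrow> f a > 0 \<Longrightarrow> f (refls as a) > 0"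
  shows "refls as x = x"
proof -
  have "refls as x = x"
    if "set as \<subseteq> indec" "\<And>a. a \<in> R \<Longrightarrow> f a > 0 \<Longrightarrow> f (refls as a) > 0" for as
    using that
  proof (induction "length as" arbitrary: as rule: less_induct)
    case less
    show ?case
    proof (cases as rule: rev_cases)
      case (snoc cs a)
      then have a: "a \<in> indec" "a \<in> R" "f a > 0"
        using less.prems by (auto simp: indec_def)
      then have "f (refls cs a) < 0"
        using less.prems(2)[of a] snoc by (simp add: refls_append refl_self K_nz refls_minus f_minus)
      then obtain bs where bs: "set bs \<subseteq> indec" "length bs < length cs"
          "\<And>x. refls cs (refl a x) = refls bs x"
        using exchange[of cs a] less.prems(1) snoc a by auto
      then have "refls as y = refls bs y" for y
        by (simp add: snoc refls_append)
      then show ?thesis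
        using less.hyps[of bs] bs less.prems(2) snoc by simp
    qed simp
  qed
  then show ?thesis
    using refls_eq_refls_indec[OF assms(1)] assms(2) by metis
qed

end

section \<open>Transitivity on positive systems, and the even subsystem\<close>

context root_system
begin

text \<open>Induction on the number of roots on which \<open>f\<close> and \<open>g\<close>
  disagree. If they disagree at all, they disagree on some simple root of \<open>f\<close>, and
  reflecting \<open>g\<close> in it repairs this root while permuting the other positive
  ones.\<close>

theorem exists_refls_pos:
  assumes f: "height f" and g: "height g"
  shows "\<exists>as. set as \<subseteq> R \<and> (\<forall>a\<in>R. f a > 0 \<longrightarrow> g (refls as a) > 0)"
  using g
proof (induction "card {a \<in> R. f a > 0 \<and> g a < 0}" arbitrary: g rule: less_induct)
  case less
  interpret f: root_system_height scale K R f
    by standard (rule f)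
  interpret g: root_system_height scale K R g
    by standard (rule less.prems)
  show ?case
  proof (cases "\<exists>a\<in>f.indec. g a < 0")
    case False
    have "g a > 0" if "a \<in> R" "f a > 0" for a
      using that
    proof (induction rule: f.pos_induct)
      case (indec a)
      then show ?case
        using False g.f_nz[of a] f.indec_R by force
    qed (simp add: g.f_add)
    then show ?thesis
      by (intro exI[of _ "[]"]) auto
  next
    case True
    then obtain a where a: "a \<in> f.indec" "g a < 0" "a \<in> R" "f a > 0"
      by (auto simp: f.indec_def)
    let ?g = "\<lambda>x. g (refl a x)"
    have "height ?g"
      using height_refls[of g "[a]"] less.prems a by simp
    let ?S = "{b \<in> R. f b > 0 \<and> ?g b < 0}" and ?T = "{b \<in> R. f b > 0 \<and> g b < 0}"
    have nz: "K a a \<noteq> 0"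
      using K_nz a by auto
    \<comment> \<open>The strict decrease: \<open>a\<close> is a disagreement for \<open>g\<close>
      that is not hit by any disagreement of the reflected functional.\<close>
    have image: "refl a ` ?S \<subseteq> ?T - {a}"
    proof (intro image_subsetI)
      fix b assume b: "b \<in> ?S"
      then have "b \<noteq> a"
        using a nz by (auto simp: refl_self g.f_minus)
      moreover have "refl a b \<noteq> a"
      proof
        assume "refl a b = a"
        then have "b = - a"
          using refl_refl[OF nz, of b] refl_self[OF nz] by simp
        then show False
          using b a f.f_minus[of a] by simp
      qed
      ultimately show "refl a b \<in> ?T - {a}"
        using b f.refl_indec_pos a refl_R by auto
    qed
    have "inj_on (refl a) ?S"
      by (rule inj_on_inverseI[of _ "refl a"]) (simp add: refl_refl nz)
    from card_inj_on_le[OF this image] have "card ?S \<le> card (?T - {a})"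
      using finite_R by auto
    also have "\<dots> < card ?T"
      using a finite_R by (intro psubset_card_mono) auto
    finally obtain as where "set as \<subseteq> R" "\<forall>b\<in>R. f b > 0 \<longrightarrow> ?g (refls as b) > 0"
      using less.hyps[OF _ \<open>height ?g\<close>] by auto
    then show ?thesis
      using a by (intro exI[of _ "a # as"]) auto
  qed
qed

text \<open>Reflected roots and string members are integer combinations of \<open>a\<close> and
  \<open>b\<close>, and an integer combination of roots that are even on \<open>t\<close> is even on
  \<open>t\<close>.\<close>

lemma root_system_even:
  assumes "\<And>a. a \<in> R \<Longrightarrow> \<exists>m::int. K a t = of_int m"
  shows "root_system scale K {a \<in> R. \<exists>m::int. K a t = 2 * of_int m}"
proof
  show "finite {a \<in> R. \<exists>m::int. K a t = 2 * of_int m}"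
    using finite_R by auto
next
  fix a b assume a: "a \<in> {a \<in> R. \<exists>m::int. K a t = 2 * of_int m}" and b: "b \<in> {a \<in> R. \<exists>m::int. K a t = 2 * of_int m}"
  then obtain m n where mn: "K a t = 2 * of_int m" "K b t = 2 * of_int n"
    by auto
  obtain k where k: "cart b a = of_int k"
    using cart_int a b by blast
  have "K (refl a b) t = 2 * of_int (n - k * m)"
    by (simp add: refl_def K_diff K_scale k mn algebra_simps)
  then show "refl a b \<in> {a \<in> R. \<exists>m::int. K a t = 2 * of_int m}"
    using a b refl_R by blast
  fix n' j :: nat assume "b \<noteq> a" "cart b a = of_nat n'" "j \<le> n'"
  moreover have "K (b - of_nat j *c a) t = 2 * of_int (n - j * m)"
    by (simp add: K_diff K_scale mn algebra_simps)
  ultimately show "b - of_nat j *c a \<in> {a \<in> R. \<exists>m::int. K a t = 2 * of_int m}"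
    using string a b by blast
qed (use K_pos cart_int in auto)

end

section \<open>Traces and simultaneous diagonalization\<close>

text \<open>
  A separate locale, because additions to \<^locale>\<open>vector_space\<close> would be shadowed at once by
  their instances for the global interpretation \<open>real_vector\<close>.
\<close>

locale vector_space_endo = vector_space
begin

abbreviation endo :: "('b \<Rightarrow> 'b) \<Rightarrow> bool" where
  "endo \<equiv> Vector_Spaces.linear scale scale"

text \<open>\<open>B\<close> may be a basis of a proper subspace; if \<open>f\<close> preserves that
  subspace, this is the trace of the restriction.\<close>

definition trace_on :: "'b set \<Rightarrow> ('b \<Rightarrow> 'b) \<Rightarrow> 'a" where
  "trace_on B f = (\<Sum>b\<in>B. representation B (f b) b)"

text \<open>With \<open>B = C\<close> this is the rule for matrix products, with \<open>f\<close>
  the identity it is the change of basis.\<close>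

lemma representation_endo:
  assumes f: "endo f" and B: "independent B" and C: "independent C" "finite C"
    and v: "v \<in> span C" and fC: "\<And>c. c \<in> C \<Longrightarrow> f c \<in> span B"
  shows "representation B (f v) b = (\<Sum>c\<in>C. representation C v c * representation B (f c) b)"
proof -
  interpret f: Vector_Spaces.linear scale scale f by fact
  have "v = (\<Sum>c\<in>C. representation C v c *s c)"
    using sum_representation_eq[OF C(1) v C(2) order_refl] by simp
  then have "f v = (\<Sum>c\<in>C. representation C v c *s f c)"
    by (metis (mono_tags, lifting) f.sum f.scale sum.cong)
  then show ?thesis
    using B fC by (simp add: representation_sum representation_scale span_scale)
qed

lemma trace_on_comm:
  assumes "endo f" "endo g" "independent B" "finite B"
    and fB: "\<And>b. b \<in> B \<Longrightarrow> f b \<in> span B" and gB: "\<And>b. b \<in> B \<Longrightarrow> g b \<in> span B"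
  shows "trace_on B (\<lambda>x. f (g x)) = trace_on B (\<lambda>x. g (f x))"
proof -
  have "trace_on B (\<lambda>x. f (g x))
      = (\<Sum>b\<in>B. \<Sum>c\<in>B. representation B (g b) c * representation B (f c) b)"
    unfolding trace_on_def using assms by (intro sum.cong refl representation_endo) auto
  also have "\<dots> = (\<Sum>c\<in>B. \<Sum>b\<in>B. representation B (f c) b * representation B (g b) c)"
    by (subst sum.swap) (simp add: mult.commute)
  also have "\<dots> = trace_on B (\<lambda>x. g (f x))"
    unfolding trace_on_def using assms by (intro sum.cong refl representation_endo[symmetric]) auto
  finally show ?thesis .
qed

lemma trace_on_basis_indep:
  assumes f: "endo f" and B: "independent B" "finite B" and C: "independent C" "finite C"
    and "span B = UNIV" "span C = UNIV"
  shows "trace_on B f = trace_on C f"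
proof -
  have "trace_on B f = (\<Sum>b\<in>B. \<Sum>c\<in>C. representation C b c * representation B (f c) b)"
    unfolding trace_on_def using assms by (intro sum.cong refl representation_endo) auto
  also have "\<dots> = (\<Sum>c\<in>C. \<Sum>b\<in>B. representation B (f c) b * representation C b c)"
    by (subst sum.swap) (simp add: mult.commute)
  also have "\<dots> = trace_on C f"
  proof -
    \<comment> \<open>The identity map supplies the transition matrix from \<open>B\<close> to
      \<open>C\<close>.\<close>
    have "endo (\<lambda>x. x)"
      by (simp add: Vector_Spaces.linear_iff vector_space_axioms)
    from representation_endo[OF this C(1) B, of "f c" c for c]
    have "representation C (f c) c = (\<Sum>b\<in>B. representation B (f c) b * representation C b c)" for c
      using assms(6,7) by (metis UNIV_I)
    then show ?thesis
      by (simp only: trace_on_def)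
  qed
  finally show ?thesis .
qed

lemma trace_on_diff:
  assumes "independent B" "\<And>b. b \<in> B \<Longrightarrow> f b \<in> span B" "\<And>b. b \<in> B \<Longrightarrow> g b \<in> span B"
  shows "trace_on B (\<lambda>x. f x - g x) = trace_on B f - trace_on B g"
  using assms by (simp add: trace_on_def representation_diff sum_subtractf)

lemma trace_on_add:
  assumes "independent B" "\<And>b. b \<in> B \<Longrightarrow> f b \<in> span B" "\<And>b. b \<in> B \<Longrightarrow> g b \<in> span B"
  shows "trace_on B (\<lambda>x. f x + g x) = trace_on B f + trace_on B g"
  using assms by (simp add: trace_on_def representation_add sum.distrib)

lemma trace_on_scale:
  assumes "independent B" "\<And>b. b \<in> B \<Longrightarrow> f b \<in> span B"
  shows "trace_on B (\<lambda>x. c *s f x) = c * trace_on B f"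
  using assms by (simp add: trace_on_def representation_scale sum_distrib_left)

lemma trace_on_diagonal:
  assumes "independent B" "\<And>b. b \<in> B \<Longrightarrow> f b = m b *s b"
  shows "trace_on B f = (\<Sum>b\<in>B. m b)"
  unfolding trace_on_def using assms
  by (intro sum.cong refl) (simp add: representation_scale representation_basis span_base)

text \<open>Applying \<open>T - d\<close> removes the summand with eigenvalue \<open>d\<close> and
  multiplies each other one by the nonzero factor \<open>c - d\<close>.\<close>

lemma eigenvectors_sum_zero:
  assumes T: "endo T" and "finite C" "\<And>c. c \<in> C \<Longrightarrow> T (u c) = c *s u c" "(\<Sum>c\<in>C. u c) = 0"
  shows "\<forall>c\<in>C. u c = 0"
  using assms(2-)
proof (induction C arbitrary: u rule: finite_induct)
  case (insert d C)
  interpret T: Vector_Spaces.linear scale scale T by fact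
  have sum: "u d + (\<Sum>c\<in>C. u c) = 0"
    using insert by simp
  then have "T (u d) + (\<Sum>c\<in>C. T (u c)) - d *s (u d + (\<Sum>c\<in>C. u c)) = 0"
    by (metis T.add T.sum T.zero diff_0_right scale_zero_right)
  then have "(\<Sum>c\<in>C. (c - d) *s u c) = 0"
    using insert.prems by (simp add: scale_right_distrib scale_sum_right scale_left_diff_distrib sum_subtractf)
  moreover have "T ((c - d) *s u c) = c *s ((c - d) *s u c)" if "c \<in> C" for c
    using insert.prems that by (simp add: T.scale mult.commute)
  ultimately have "\<forall>c\<in>C. (c - d) *s u c = 0"
    by (rule insert.IH[rotated])
  then have "\<forall>c\<in>C. u c = 0"
    using insert.hyps by auto
  then show ?case
    using sum by simp
qed simp

lemma eigenvector_decomposition: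
  assumes T: "endo T" and v: "v \<in> span {v. \<exists>c. T v = c *s v}"
  shows "\<exists>C u. finite C \<and> (\<forall>c. T (u c) = c *s u c) \<and> v = (\<Sum>c\<in>C. u c)"
proof -
  interpret T: Vector_Spaces.linear scale scale T by fact
  \<comment> \<open>The family is indexed by the eigenvalues themselves. Requiring it to vanish
    outside \<open>C\<close> lets a new eigenvector be added in the same way whether or not its
    eigenvalue already occurs.\<close>
  let ?P = "\<lambda>v. \<exists>C u. finite C \<and> (\<forall>c. T (u c) = c *s u c) \<and> (\<forall>c. c \<notin> C \<longrightarrow> u c = 0) \<and> v = (\<Sum>c\<in>C. u c)"
  from v have "?P v"
  proof (induction rule: span_induct_alt)
    case base
    show ?case
      by (intro exI[of _ "{}"] exI[of _ "\<lambda>_. 0"]) (simp add: T.zero)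
  next
    case (step k x y)
    then obtain d C u where d: "T x = d *s x" and C: "finite C" "\<forall>c. T (u c) = c *s u c"
        "\<forall>c. c \<notin> C \<longrightarrow> u c = 0" "y = (\<Sum>c\<in>C. u c)"
      by auto
    let ?u = "\<lambda>c. (if c = d then k *s x else 0) + u c"
    have "(\<Sum>c\<in>insert d C. ?u c) = k *s x + (\<Sum>c\<in>insert d C. u c)"
      using C by (simp add: sum.distrib sum.delta)
    also have "(\<Sum>c\<in>insert d C. u c) = y"
      using C by (simp add: sum.insert_if)
    finally have "k *s x + y = (\<Sum>c\<in>insert d C. ?u c)" ..
    moreover have "T (?u c) = c *s ?u c" for c
      using C d by (simp add: T.add T.scale T.zero scale_right_distrib mult.commute)
    ultimately show ?case
      using C by (intro exI[of _ "insert d C"] exI[of _ ?u]) auto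
  qed
  then show ?thesis by blast
qed

text \<open>A common eigenvector of \<open>F\<close> splits into eigenvectors of the new operator
  \<open>g\<close>. For \<open>f\<close> in \<open>F\<close> with eigenvalue \<open>m\<close>, the
  map \<open>f - m\<close> commutes with \<open>g\<close>, so it keeps each component in its
  eigenspace; the images add up to 0 and hence vanish one by one.\<close>

lemma simultaneous_diagonalization:
  assumes "finite F" and "\<And>f. f \<in> F \<Longrightarrow> endo f"
    and "\<And>f. f \<in> F \<Longrightarrow> span {v. \<exists>c. f v = c *s v} = UNIV"
    and "\<And>f g x. f \<in> F \<Longrightarrow> g \<in> F \<Longrightarrow> f (g x) = g (f x)"
  shows "span {v. \<forall>f\<in>F. \<exists>c. f v = c *s v} = UNIV"
  using assms
proof (induction F rule: finite_induct)
  case (insert g F)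
  let ?E = "\<lambda>F. {v. \<forall>f\<in>F. \<exists>c. f v = c *s v}"
  have g: "endo g"
    using insert.prems by simp
  interpret g: Vector_Spaces.linear scale scale g by fact
  have "?E F \<subseteq> span (?E (insert g F))"
  proof
    fix v assume v: "v \<in> ?E F"
    obtain C u where C: "finite C" "\<forall>c. g (u c) = c *s u c" "v = (\<Sum>c\<in>C. u c)"
      using eigenvector_decomposition[OF g, of v] insert.prems(2)[of g] by auto
    have uE: "u c \<in> ?E (insert g F)" if "c \<in> C" for c
    proof -
      have "\<exists>m. f (u c) = m *s u c" if f: "f \<in> F" for f
      proof -
        interpret f: Vector_Spaces.linear scale scale f
          using insert.prems f by simp
        obtain m where m: "f v = m *s v"
          using v f by auto
        have "(\<Sum>c\<in>C. f (u c) - m *s u c) = 0"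
          using m C by (simp add: f.sum sum_subtractf scale_sum_right)
        moreover have "g (f (u c) - m *s u c) = c *s (f (u c) - m *s u c)" for c
        proof -
          have "g (f (u c)) = f (g (u c))"
            using insert.prems(3) f by blast
          also have "\<dots> = c *s f (u c)"
            unfolding C(2)[rule_format] by (rule f.scale)
          finally have "g (f (u c) - m *s u c) = c *s f (u c) - m *s (c *s u c)"
            unfolding g.diff g.scale C(2)[rule_format] by (rule arg_cong)
          then show ?thesis
            by (simp only: scale_right_diff_distrib scale_left_commute)
        qed
        ultimately have "\<forall>c\<in>C. f (u c) - m *s u c = 0"
          by (intro eigenvectors_sum_zero[OF g C(1)])
        then have "f (u c) = m *s u c"
          using \<open>c \<in> C\<close> by simp
        then show ?thesis ..
      qed
      then show ?thesis
        using C by auto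
    qed
    then show "v \<in> span (?E (insert g F))"
      unfolding C(3) by (intro span_sum span_base uE)
  qed
  then have "span (?E F) \<subseteq> span (?E (insert g F))"
    by (simp add: span_minimal)
  then show ?case
    using insert by auto
qed simp

end

section \<open>Brackets and the invariance of the Killing form\<close>

sublocale complex_lie_algebra \<subseteq> vector_space_endo scale ..

context complex_lie_algebra
begin

lemma endo_br: "endo (br x)"
  by (simp add: Vector_Spaces.linear_iff vector_space_axioms br_add_right br_scale_right)

lemma br_0 [simp]: "br x 0 = 0" "br 0 x = 0"
  using br_scale_right[of x 0 0] br_scale_left[of 0 0 x] by simp_all

lemma br_minus: "br x (- y) = - br x y" "br (- x) y = - br x y"
  using br_scale_right[of x "-1" y] br_scale_left[of "-1" x y] by simp_all

lemma br_diff: "br x (y - z) = br x y - br x z" "br (x - y) z = br x z - br y z"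
  using br_add_right[of x y "- z"] br_add_left[of x "- y" z] by (simp_all add: br_minus)

lemma br_swap: "br y x = - br x y"
proof -
  have "br (x + y) (x + y) = br x y + br y x"
    by (simp only: br_add_left br_add_right) (simp add: br_self)
  then have "br x y + br y x = 0"
    by (simp add: br_self)
  then show ?thesis
    by (simp add: eq_neg_iff_add_eq_0 add.commute)
qed

lemma br_br: "br (br x y) z = br x (br y z) - br y (br x z)"
proof -
  have "br y (br z x) = - br y (br x z)"
    by (metis br_swap br_minus(1))
  then show ?thesis
    using jacobi[of x y z] br_swap[of "br x y" z] by (simp add: algebra_simps)
qed

lemma br_derivation: "br t (br x y) = br (br t x) y + br x (br t y)"
  by (simp add: br_br)

lemma endo_br_br: "endo (\<lambda>z. br x (br y z))"
  by (simp add: Vector_Spaces.linear_iff vector_space_axioms br_add_right br_scale_right)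

end

locale fd_lie_algebra = complex_lie_algebra +
  assumes fd: finite_dim
begin

lemma finite_indep: "independent S \<Longrightarrow> finite S"
  using fd independent_span_bound unfolding finite_dim_def by blast

lemma ext_basis: "independent (extend_basis {})" "finite (extend_basis {})" "span (extend_basis {}) = UNIV"
  using independent_extend_basis[OF independent_empty] finite_indep span_extend_basis[OF independent_empty]
  by auto

lemma killing_trace_on:
  assumes "independent B" "span B = UNIV"
  shows "killing x y = trace_on B (\<lambda>z. br x (br y z))"
  using trace_on_basis_indep[OF endo_br_br assms(1) _ ext_basis(1,2) assms(2) ext_basis(3)]
    finite_indep assms
  by (simp add: killing_def trace_op_def trace_on_def)

lemma killing_ext: "killing x y = trace_on (extend_basis {}) (\<lambda>z. br x (br y z))"
  by (rule killing_trace_on) (use ext_basis in auto)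

sublocale killing: symmetric_form scale killing
proof
  show "killing (x + y) z = killing x z + killing y z" for x y z
    unfolding killing_ext br_add_left by (rule trace_on_add) (use ext_basis in auto)
  show "killing (c *c x) y = c * killing x y" for c x y
    unfolding killing_ext br_scale_left by (rule trace_on_scale) (use ext_basis in auto)
  show "killing x y = killing y x" for x y
    unfolding killing_ext by (rule trace_on_comm) (use ext_basis endo_br in auto)
qed

text \<open>For the adjoint operators, cyclicity turns tr(YXZ) into tr(XZY), and so tr([X,Y]Z) into
  tr(X[Y,Z]).\<close>

lemma killing_invariant: "killing (br x y) z = killing x (br y z)"
proof -
  let ?B = "extend_basis {}"
  have "killing (br x y) z = trace_on ?B (\<lambda>u. br x (br y (br z u)) - br y (br x (br z u)))"
    by (simp add: killing_ext br_br)
  also have "\<dots> = trace_on ?B (\<lambda>u. br x (br y (br z u))) - trace_on ?B (\<lambda>u. br y (br x (br z u)))"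
    by (rule trace_on_diff) (use ext_basis in auto)
  also have "trace_on ?B (\<lambda>u. br y (br x (br z u))) = trace_on ?B (\<lambda>u. br x (br z (br y u)))"
    by (rule trace_on_comm) (use ext_basis endo_br endo_br_br in auto)
  also have "trace_on ?B (\<lambda>u. br x (br y (br z u))) - \<dots>
      = trace_on ?B (\<lambda>u. br x (br y (br z u)) - br x (br z (br y u)))"
    by (rule trace_on_diff[symmetric]) (use ext_basis in auto)
  also have "\<dots> = killing x (br y z)"
    by (simp add: killing_ext br_br br_diff)
  finally show ?thesis .
qed

lemma killing_ideal: "ideal {x. \<forall>y. killing x y = 0}"
  unfolding ideal_def subspace_def
  by (auto simp: killing.K_add killing.K_scale)
    (metis br_swap killing.K_minus(1) killing_invariant neg_equal_0_iff_equal)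

end

section \<open>Weights and the Killing form\<close>

locale simple_lie_cartan = lie_algebra_with_cartan scale br h
  for scale :: "complex \<Rightarrow> 'g::ab_group_add \<Rightarrow> 'g"  (infixr \<open>*c\<close> 75)
  and br :: "'g \<Rightarrow> 'g \<Rightarrow> 'g"
  and h :: "'g set" +
  assumes fd_g: "finite_dim"
    and simple_g: "simple"
    and cartan_h: "cartan_subalgebra h"

sublocale simple_lie_cartan \<subseteq> fd_lie_algebra scale br
  by standard (rule fd_g)

context simple_lie_cartan
begin

lemma subspace_h: "subspace h"
  and br_h: "x \<in> h \<Longrightarrow> y \<in> h \<Longrightarrow> br x y = 0"
  and h_maximal: "abelian_subalgebra H \<Longrightarrow> h \<subseteq> H \<Longrightarrow> H = h"
  and h_diag: "x \<in> h \<Longrightarrow> span {v. \<exists>c. br x v = c *c v} = UNIV"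
  using cartan_h unfolding cartan_subalgebra_def abelian_subalgebra_def by auto

text \<open>Weights are functions on the whole space of which only the values on \<open>h\<close>
  count. Sums and multiples of weights can thus be formed without restricting, and
  \<open>wspace_cong\<close> identifies functions that agree on \<open>h\<close>.\<close>

definition wspace :: "('g \<Rightarrow> complex) \<Rightarrow> 'g set" where
  "wspace \<mu> = {v. \<forall>x\<in>h. br x v = \<mu> x *c v}"

lemma wspace_cong: "(\<And>x. x \<in> h \<Longrightarrow> \<mu> x = \<nu> x) \<Longrightarrow> wspace \<mu> = wspace \<nu>"
  by (auto simp: wspace_def)

lemma subspace_wspace: "subspace (wspace \<mu>)"
  by (auto simp: subspace_def wspace_def br_add_right br_scale_right scale_right_distrib mult.commute)

text \<open>An element commuting with \<open>h\<close> spans together with \<open>h\<close> an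
  abelian subalgebra, and maximality puts it into \<open>h\<close>.\<close>

lemma wspace_0: "wspace (\<lambda>_. 0) = h"
proof
  show "wspace (\<lambda>_. 0) \<subseteq> h"
  proof
    fix x assume x: "x \<in> wspace (\<lambda>_. 0)"
    then have x0: "br y x = 0" "br x y = 0" if "y \<in> h" for y
      using that br_swap[of y x] by (auto simp: wspace_def)
    let ?H = "span (insert x h)"
    have H: "\<exists>k. \<exists>y\<in>h. u = k *c x + y" if "u \<in> ?H" for u
    proof -
      obtain k where "u - k *c x \<in> span h"
        using \<open>u \<in> ?H\<close> unfolding span_insert by blast
      then have "u - k *c x \<in> h"
        using subspace_h span_minimal[of h h] by blast
      then show ?thesis
        by (intro exI[of _ k] bexI[of _ "u - k *c x"]) simp
    qed
    have "br u w = 0" if "u \<in> ?H" "w \<in> ?H" for u w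
    proof -
      obtain k y l z where "y \<in> h" "z \<in> h" "u = k *c x + y" "w = l *c x + z"
        using H \<open>u \<in> ?H\<close> \<open>w \<in> ?H\<close> by metis
      then show ?thesis
        by (simp add: br_add_left br_add_right br_scale_left br_scale_right br_self br_h x0)
    qed
    then have "?H = h"
      by (intro h_maximal) (auto simp: abelian_subalgebra_def intro: span_base)
    then show "x \<in> h"
      using span_base[of x "insert x h"] by auto
  qed
qed (auto simp: wspace_def br_h)

lemma wspace_br:
  assumes "x \<in> wspace \<mu>" "y \<in> wspace \<nu>"
  shows "br x y \<in> wspace (\<lambda>t. \<mu> t + \<nu> t)"
  using assms
  by (auto simp: wspace_def br_derivation[of _ x y] br_scale_left br_scale_right scale_left_distrib)

definition weight_vectors :: "'g set" where
  "weight_vectors = {v. \<exists>\<mu>. v \<in> wspace \<mu>}"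

text \<open>Simultaneous diagonalization applies to finitely many operators, so it is used for a
  basis of \<open>h\<close>; a common eigenvector for the basis is one for all of \<open>h\<close>
  by linearity of the bracket.\<close>

lemma span_weight_vectors: "span weight_vectors = UNIV"
proof -
  obtain X where X: "X \<subseteq> h" "independent X" "h \<subseteq> span X"
    using maximal_independent_subset by blast
  have diag: "span {v. \<forall>f\<in>br ` X. \<exists>c. f v = c *c v} = UNIV"
  proof (rule simultaneous_diagonalization)
    show "finite (br ` X)"
      using X finite_indep by simp
    show "f (g x) = g (f x)" if "f \<in> br ` X" "g \<in> br ` X" for f g x
    proof -
      obtain y z where "f = br y" "g = br z" "y \<in> h" "z \<in> h"
        using X \<open>f \<in> br ` X\<close> \<open>g \<in> br ` X\<close> by auto
      then show ?thesis
        using br_br[of y z x] br_h by simp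
    qed
  qed (use X h_diag endo_br in auto)
  have "{v. \<forall>f\<in>br ` X. \<exists>c. f v = c *c v} \<subseteq> weight_vectors"
  proof
    fix v assume v: "v \<in> {v. \<forall>f\<in>br ` X. \<exists>c. f v = c *c v}"
    have "\<exists>c. br x v = c *c v" if "x \<in> span X" for x
      using that
    proof (induction rule: span_induct_alt)
      case base
      show ?case by (intro exI[of _ 0]) simp
    next
      case (step k x y)
      obtain c where "br x v = c *c v"
        using v step by blast
      moreover obtain d where "br y v = d *c v"
        using step by blast
      ultimately show ?case
        by (intro exI[of _ "k * c + d"]) (simp add: br_add_left br_scale_left scale_left_distrib)
    qed
    then have "\<forall>x\<in>h. \<exists>c. br x v = c *c v"
      using X by blast
    from bchoice[OF this] obtain \<mu> where "\<forall>x\<in>h. br x v = \<mu> x *c v" ..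
    then have "v \<in> wspace \<mu>"
      by (simp add: wspace_def)
    then show "v \<in> weight_vectors"
      by (auto simp: weight_vectors_def)
  qed
  from span_mono[OF this] show ?thesis
    unfolding diag by auto
qed

definition weight_basis :: "'g set \<Rightarrow> bool" where
  "weight_basis B \<longleftrightarrow> independent B \<and> span B = UNIV \<and> B \<subseteq> weight_vectors"

lemma weight_basisD:
  assumes "weight_basis B"
  shows "independent B" "span B = UNIV" "B \<subseteq> weight_vectors" "finite B"
  using assms finite_indep by (auto simp: weight_basis_def)

lemma weight_basis_extend:
  assumes "independent S" "S \<subseteq> weight_vectors"
  obtains B where "S \<subseteq> B" "weight_basis B"
proof -
  obtain B where "S \<subseteq> B" "B \<subseteq> weight_vectors" "independent B" "weight_vectors \<subseteq> span B"
    using maximal_independent_subset_extend assms by blast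
  moreover from this have "span B = UNIV"
    using span_weight_vectors span_minimal[of weight_vectors "span B"] by auto
  ultimately show ?thesis
    using that by (auto simp: weight_basis_def)
qed

lemma weight_basis_exists: obtains B where "weight_basis B"
  using weight_basis_extend[of "{}"] independent_empty by auto

text \<open>The value is unspecified for the zero vector, which is harmless in
  \<open>wt_wspace\<close> because 0 lies in every weight space.\<close>

definition wt :: "'g \<Rightarrow> 'g \<Rightarrow> complex" where
  "wt v = (\<lambda>x. THE c. br x v = c *c v)"

lemma wt_eq: "v \<in> wspace \<mu> \<Longrightarrow> v \<noteq> 0 \<Longrightarrow> x \<in> h \<Longrightarrow> wt v x = \<mu> x"
  unfolding wt_def wspace_def by (rule the_equality) auto

lemma wt_wspace: "v \<in> weight_vectors \<Longrightarrow> v \<in> wspace (wt v)"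
proof (cases "v = 0")
  case False
  assume "v \<in> weight_vectors"
  then obtain \<mu> where \<mu>: "v \<in> wspace \<mu>"
    by (auto simp: weight_vectors_def)
  then have "wspace (wt v) = wspace \<mu>"
    using False by (intro wspace_cong) (simp add: wt_eq)
  then show ?thesis
    using \<mu> by simp
qed (simp add: wspace_def)

lemma br_wt: "v \<in> weight_vectors \<Longrightarrow> x \<in> h \<Longrightarrow> br x v = wt v x *c v"
  using wt_wspace by (auto simp: wspace_def)

definition weight :: "('g \<Rightarrow> complex) \<Rightarrow> bool" where
  "weight \<mu> \<longleftrightarrow> (\<exists>v\<in>wspace \<mu>. v \<noteq> 0)"

lemma weight_cong: "(\<And>x. x \<in> h \<Longrightarrow> \<mu> x = \<nu> x) \<Longrightarrow> weight \<mu> = weight \<nu>"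
  using wspace_cong[of \<mu> \<nu>] by (simp add: weight_def)

lemma basis_nonzero: "weight_basis B \<Longrightarrow> b \<in> B \<Longrightarrow> b \<noteq> 0"
  using dependent_zero weight_basisD(1) by blast

lemma weight_wt: "weight_basis B \<Longrightarrow> b \<in> B \<Longrightarrow> weight (wt b)"
  using wt_wspace basis_nonzero weight_basisD(3) unfolding weight_def by blast

text \<open>Applying \<open>br x - \<mu> x\<close> to the expansion of \<open>v\<close> multiplies
  the coefficient of \<open>b\<close> by \<open>wt b x - \<mu> x\<close> and gives 0, so only basis
  vectors of weight \<open>\<mu>\<close> occur.\<close>

lemma wspace_span:
  assumes B: "weight_basis B" and v: "v \<in> wspace \<mu>"
  shows "v \<in> span {b\<in>B. \<forall>x\<in>h. wt b x = \<mu> x}"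
proof -
  note B' = weight_basisD[OF B]
  define r where "r = representation B v"
  have v_sum: "v = (\<Sum>b\<in>B. r b *c b)"
    unfolding r_def using sum_representation_eq[of B v B] B' by simp
  have r0: "r b * (wt b x - \<mu> x) = 0" if x: "x \<in> h" and b: "b \<in> B" for x b
  proof -
    interpret x: Vector_Spaces.linear scale scale "br x"
      by (rule endo_br)
    have "(\<Sum>b\<in>B. (r b * (wt b x - \<mu> x)) *c b) = br x (\<Sum>b\<in>B. r b *c b) - \<mu> x *c (\<Sum>b\<in>B. r b *c b)"
      unfolding x.sum x.scale scale_sum_right sum_subtractf[symmetric]
      using B' br_wt x by (intro sum.cong refl) (auto simp: algebra_simps)
    also have "\<dots> = 0"
      using v x unfolding v_sum[symmetric] by (simp add: wspace_def)
    finally show ?thesis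
      using independentD[OF B'(1,4) order_refl _ b, of "\<lambda>b. r b * (wt b x - \<mu> x)"] by simp
  qed
  have "r b *c b \<in> span {b\<in>B. \<forall>x\<in>h. wt b x = \<mu> x}" if "b \<in> B" for b
  proof (cases "r b = 0")
    case False
    then have "b \<in> {b\<in>B. \<forall>x\<in>h. wt b x = \<mu> x}"
      using r0 that by auto
    then show ?thesis
      by (intro span_scale span_base)
  qed (simp add: span_zero)
  then show ?thesis
    unfolding v_sum by (rule span_sum)
qed

lemma weight_in_basis:
  assumes "weight_basis B" "weight \<mu>"
  shows "\<exists>b\<in>B. \<forall>x\<in>h. wt b x = \<mu> x"
proof (rule ccontr)
  assume "\<not> ?thesis"
  then have empty: "{b\<in>B. \<forall>x\<in>h. wt b x = \<mu> x} = {}"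
    by auto
  obtain v where "v \<in> wspace \<mu>" "v \<noteq> 0"
    using assms by (auto simp: weight_def)
  then show False
    using wspace_span[OF assms(1), of v \<mu>] unfolding empty by simp
qed

text \<open>
  The only input from representation theory: the operator \<open>ad [e, f]\<close> has trace zero on every
  subspace stable under \<open>ad e\<close> and \<open>ad f\<close>.
\<close>

lemma stable_sum_wt:
  assumes B: "independent B" "B \<subseteq> weight_vectors"
    and e: "\<And>b. b \<in> B \<Longrightarrow> br e b \<in> span B" and f: "\<And>b. b \<in> B \<Longrightarrow> br f b \<in> span B"
    and t: "br e f \<in> h"
  shows "(\<Sum>b\<in>B. wt b (br e f)) = 0"
proof -
  have stable: "br x y \<in> span B" if "\<And>b. b \<in> B \<Longrightarrow> br x b \<in> span B" "y \<in> span B" for x y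
    using that(2)
  proof (induction rule: span_induct_alt)
    case (step c b y)
    then show ?case
      using that(1) by (simp add: br_add_right br_scale_right span_add span_scale)
  qed (simp add: span_zero)
  have "(\<Sum>b\<in>B. wt b (br e f)) = trace_on B (br (br e f))"
    using B t br_wt by (intro trace_on_diagonal[symmetric]) auto
  also have "\<dots> = trace_on B (\<lambda>z. br e (br f z) - br f (br e z))"
    by (simp add: br_br[abs_def])
  also have "\<dots> = trace_on B (\<lambda>z. br e (br f z)) - trace_on B (\<lambda>z. br f (br e z))"
    using B(1) e f stable by (intro trace_on_diff) auto
  also have "\<dots> = 0"
    using trace_on_comm[of "br e" "br f" B] B(1) e f finite_indep endo_br by simp
  finally show ?thesis .
qed

abbreviation shift :: "('g \<Rightarrow> complex) \<Rightarrow> ('g \<Rightarrow> complex) \<Rightarrow> int \<Rightarrow> 'g \<Rightarrow> complex" where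
  "shift \<beta> \<alpha> j \<equiv> (\<lambda>x. \<beta> x + of_int j * \<alpha> x)"

abbreviation neg :: "('g \<Rightarrow> complex) \<Rightarrow> 'g \<Rightarrow> complex" where
  "neg \<alpha> \<equiv> (\<lambda>x. - \<alpha> x)"

lemma br_e_f: "e \<in> wspace \<alpha> \<Longrightarrow> f \<in> wspace (neg \<alpha>) \<Longrightarrow> br e f \<in> h"
  using wspace_br[of e \<alpha> f "neg \<alpha>"] by (simp add: wspace_0)

lemma wspace_subset_span:
  assumes B: "weight_basis B" and v: "v \<in> wspace \<mu>"
    and C: "weight \<mu> \<Longrightarrow> {b\<in>B. \<forall>x\<in>h. wt b x = \<mu> x} \<subseteq> C"
  shows "v \<in> span C"
proof (cases "weight \<mu>")
  case True
  then show ?thesis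
    using wspace_span[OF B v] span_mono[OF C] by blast
next
  case False
  then have "v = 0"
    using v by (auto simp: weight_def)
  then show ?thesis
    by (simp add: span_zero)
qed

text \<open>The set \<open>J\<close> selects a piece of the string that neither \<open>e\<close> nor
  \<open>f\<close> leaves. It will be the whole string, the part on one side of a gap, or the set of
  positions that carry a weight.\<close>

lemma string_sum_wt:
  assumes B: "weight_basis B" and e: "e \<in> wspace \<alpha>" and f: "f \<in> wspace (neg \<alpha>)"
    and up: "\<And>j. j \<in> J \<Longrightarrow> weight (shift \<beta> \<alpha> (j + 1)) \<Longrightarrow> j + 1 \<in> J"
    and down: "\<And>j. j \<in> J \<Longrightarrow> weight (shift \<beta> \<alpha> (j - 1)) \<Longrightarrow> j - 1 \<in> J"
  shows "(\<Sum>b | b \<in> B \<and> (\<exists>j\<in>J. \<forall>x\<in>h. wt b x = shift \<beta> \<alpha> j x). wt b (br e f)) = 0"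
proof (rule stable_sum_wt)
  let ?C = "{b \<in> B. \<exists>j\<in>J. \<forall>x\<in>h. wt b x = shift \<beta> \<alpha> j x}"
  note B' = weight_basisD[OF B]
  show "independent ?C"
    using B'(1) by (rule independent_mono) auto
  show "?C \<subseteq> weight_vectors"
    using B' by auto
  show "br e f \<in> h"
    using e f by (rule br_e_f)
  fix b assume "b \<in> ?C"
  then obtain j where j: "b \<in> B" "j \<in> J" "\<forall>x\<in>h. wt b x = shift \<beta> \<alpha> j x"
    by blast
  then have b: "b \<in> wspace (shift \<beta> \<alpha> j)"
    using wt_wspace[of b] B'(3) wspace_cong[of "wt b" "shift \<beta> \<alpha> j"] by auto
  have "br e b \<in> wspace (shift \<beta> \<alpha> (j + 1))"
    using wspace_br[OF e b] by (simp add: algebra_simps)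
  then show "br e b \<in> span ?C"
    by (rule wspace_subset_span[OF B]) (use up j in blast)
  have "br f b \<in> wspace (shift \<beta> \<alpha> (j - 1))"
    using wspace_br[OF f b] by (simp add: algebra_simps)
  then show "br f b \<in> span ?C"
    by (rule wspace_subset_span[OF B]) (use down j in blast)
qed

text \<open>With \<open>t = br e f\<close>, the trace identity on the full string reads
  \<open>N * \<beta> t + M * \<alpha> t = 0\<close> with integers \<open>N\<close> and
  \<open>M\<close>. Here \<open>N\<close> counts the basis vectors in the string and is nonzero
  because \<open>\<beta>\<close> itself occurs.\<close>

lemma weight_real_multiple:
  assumes e: "e \<in> wspace \<alpha>" and f: "f \<in> wspace (neg \<alpha>)" and \<beta>: "weight \<beta>"
  shows "\<exists>q::real. \<beta> (br e f) = of_real q * \<alpha> (br e f)"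
proof -
  obtain B where B: "weight_basis B"
    by (rule weight_basis_exists)
  let ?C = "{b \<in> B. \<exists>j\<in>UNIV. \<forall>x\<in>h. wt b x = shift \<beta> \<alpha> j x}" and ?t = "br e f"
  have "\<forall>b\<in>?C. \<exists>j. wt b ?t = \<beta> ?t + of_int j * \<alpha> ?t"
    using br_e_f[OF e f] by auto
  from bchoice[OF this] obtain j where j: "\<And>b. b \<in> ?C \<Longrightarrow> wt b ?t = \<beta> ?t + of_int (j b) * \<alpha> ?t"
    by blast
  have "(\<Sum>b\<in>?C. wt b ?t) = 0"
    by (rule string_sum_wt[OF B e f]) auto
  also have "(\<Sum>b\<in>?C. wt b ?t) = (\<Sum>b\<in>?C. \<beta> ?t + of_int (j b) * \<alpha> ?t)"
    by (rule sum.cong[OF refl j])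
  finally have "of_nat (card ?C) * \<beta> ?t + of_int (\<Sum>b\<in>?C. j b) * \<alpha> ?t = 0"
    by (simp add: sum.distrib sum_distrib_right)
  moreover obtain b where "b \<in> B" "\<forall>x\<in>h. wt b x = \<beta> x"
    using weight_in_basis[OF B \<beta>] by blast
  then have "b \<in> ?C"
    by (simp add: exI[of _ 0])
  then have "card ?C \<noteq> 0"
    using weight_basisD(4)[OF B] by auto
  ultimately have "\<beta> ?t = - (of_int (\<Sum>b\<in>?C. j b) * \<alpha> ?t) / of_nat (card ?C)"
    by (simp only: add_eq_0_iff2 nonzero_eq_divide_eq of_nat_eq_0_iff not_False_eq_True mult.commute)
  then have "\<beta> ?t = of_real (- of_int (\<Sum>b\<in>?C. j b) / of_nat (card ?C)) * \<alpha> ?t"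
    by simp
  then show ?thesis by blast
qed

section \<open>Nondegeneracy of the Killing form\<close>

lemma not_abelian: "\<exists>x y. br x y \<noteq> 0"
  and ideal_trivial: "ideal I \<Longrightarrow> I = {0} \<or> I = UNIV"
  using simple_g by (auto simp: simple_def)

lemma center_trivial:
  assumes "\<And>y. br x y = 0"
  shows "x = 0"
proof -
  have "ideal {x. \<forall>y. br x y = 0}"
    by (auto simp: ideal_def subspace_def br_add_left br_scale_left br_br)
  then show ?thesis
    using ideal_trivial not_abelian assms by blast
qed

text \<open>Such an element acts by 0 on a basis of weight vectors, so it is central.\<close>

lemma h_eq_0:
  assumes t: "t \<in> h" and zero: "\<And>\<mu>. weight \<mu> \<Longrightarrow> \<mu> t = 0"
  shows "t = 0"
proof (rule center_trivial)
  obtain B where B: "weight_basis B"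
    by (rule weight_basis_exists)
  note B' = weight_basisD[OF B]
  fix y
  have "y \<in> span B"
    using B' by simp
  then show "br t y = 0"
  proof (induction rule: span_induct_alt)
    case (step c b y)
    have "br t b = 0"
      using br_wt[of b t] t B' step zero[OF weight_wt[OF B, of b]] by auto
    then show ?case
      using step by (simp add: br_add_right br_scale_right)
  qed simp
qed

text \<open>All weights are multiples of \<open>\<alpha>\<close> at \<open>br e f\<close>; if
  \<open>\<alpha>\<close> vanished there, every weight would.\<close>

lemma br_e_f_nonzero:
  assumes "e \<in> wspace \<alpha>" "f \<in> wspace (neg \<alpha>)" "br e f \<noteq> 0"
  shows "\<alpha> (br e f) \<noteq> 0"
  using h_eq_0[OF br_e_f[OF assms(1,2)]] weight_real_multiple[OF assms(1,2)] assms(3)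
  by (metis mult_zero_right)

lemma killing_h:
  assumes B: "weight_basis B" and "x \<in> h" "y \<in> h"
  shows "killing x y = (\<Sum>b\<in>B. wt b x * wt b y)"
proof -
  note B' = weight_basisD[OF B]
  have "br x (br y b) = (wt b x * wt b y) *c b" if "b \<in> B" for b
    using br_wt assms that B' by (auto simp: br_scale_right mult.commute)
  then show ?thesis
    using B' by (simp add: killing_trace_on trace_on_diagonal)
qed

text \<open>Divided by the square of \<open>\<alpha> (br e f)\<close>, the Killing norm is a sum of
  squares of real ratios, one of which belongs to \<open>\<alpha>\<close> itself and equals
  1.\<close>

lemma killing_br_e_f:
  assumes e: "e \<in> wspace \<alpha>" and f: "f \<in> wspace (neg \<alpha>)" and nz: "br e f \<noteq> 0"
  shows "\<exists>r>0. killing (br e f) (br e f) = complex_of_real r * (\<alpha> (br e f))\<^sup>2"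
proof -
  obtain B where B: "weight_basis B"
    by (rule weight_basis_exists)
  let ?t = "br e f"
  have t: "?t \<in> h" "\<alpha> ?t \<noteq> 0"
    using br_e_f br_e_f_nonzero e f nz by auto
  have "\<forall>b\<in>B. \<exists>q::real. wt b ?t = of_real q * \<alpha> ?t"
    using weight_real_multiple[OF e f] weight_wt[OF B] by blast
  then obtain q :: "'g \<Rightarrow> real" where q: "\<And>b. b \<in> B \<Longrightarrow> wt b ?t = of_real (q b) * \<alpha> ?t"
    by metis
  have "e \<noteq> 0"
    using nz by auto
  then have "weight \<alpha>"
    using e by (auto simp: weight_def)
  then obtain b where b: "b \<in> B" "wt b ?t = \<alpha> ?t"
    using weight_in_basis[OF B] t by blast
  have "killing ?t ?t = (\<Sum>b\<in>B. of_real ((q b)\<^sup>2) * (\<alpha> ?t)\<^sup>2)"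
    unfolding killing_h[OF B t(1) t(1)] using q by (intro sum.cong) (auto simp: power2_eq_square)
  also have "\<dots> = of_real (\<Sum>b\<in>B. (q b)\<^sup>2) * (\<alpha> ?t)\<^sup>2"
    by (simp add: sum_distrib_right)
  finally have "killing ?t ?t = of_real (\<Sum>b\<in>B. (q b)\<^sup>2) * (\<alpha> ?t)\<^sup>2" .
  moreover have "q b \<noteq> 0"
    using q[OF b(1)] b t by auto
  then have "(\<Sum>b\<in>B. (q b)\<^sup>2) > 0"
    using b weight_basisD(4)[OF B] by (intro sum_pos2[of B b]) auto
  ultimately show ?thesis by blast
qed

text \<open>If all such brackets vanished, the vectors of nonzero weight would span an ideal. It is
  not zero since \<open>h\<close> is abelian, so it is everything; then no basis vector has weight
  0, hence \<open>h\<close> is zero, and with it all weights, which leaves an empty basis.\<close>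

lemma br_e_f_not_all_zero: "\<exists>\<alpha>. \<exists>e\<in>wspace \<alpha>. \<exists>f\<in>wspace (neg \<alpha>). br e f \<noteq> 0"
proof (rule ccontr)
  assume "\<not> ?thesis"
  then have zero: "br e f = 0" if "e \<in> wspace \<alpha>" "f \<in> wspace (neg \<alpha>)" for \<alpha> e f
    using that by blast
  obtain B where B: "weight_basis B"
    by (rule weight_basis_exists)
  note B' = weight_basisD[OF B]
  let ?C = "{b \<in> B. \<exists>x\<in>h. wt b x \<noteq> 0}"
  have basis: "br b c \<in> span ?C" if b: "b \<in> B" and c: "c \<in> ?C" for b c
  proof (cases "\<forall>x\<in>h. wt b x + wt c x = 0")
    case True
    then have "wspace (wt b) = wspace (neg (wt c))"
      by (intro wspace_cong) (simp add: eq_neg_iff_add_eq_0)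
    then have "br c b = 0"
      using zero[of c "wt c" b] wt_wspace B' b c by blast
    then show ?thesis
      using br_swap[of c b] by (simp add: span_zero)
  next
    case False
    have "br b c \<in> wspace (\<lambda>x. wt b x + wt c x)"
      using wt_wspace B' b c by (intro wspace_br) auto
    then show ?thesis
      by (rule wspace_subset_span[OF B]) (use False in force)
  qed
  have "br x y \<in> span ?C" if "y \<in> span ?C" for x y
  proof -
    have left: "br x c \<in> span ?C" if "c \<in> ?C" for c
    proof -
      have "x \<in> span B"
        using B' by simp
      then show ?thesis
      proof (induction rule: span_induct_alt)
        case (step k b y)
        then show ?case
          using basis[OF step(1) that] by (simp add: br_add_left br_scale_left span_add span_scale)
      qed (simp add: span_zero)
    qed
    show ?thesis
      using that
    proof (induction rule: span_induct_alt)
      case (step k c y)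
      then show ?case
        using left[OF step(1)] by (simp add: br_add_right br_scale_right span_add span_scale)
    qed (simp add: span_zero)
  qed
  then have "ideal (span ?C)"
    by (simp add: ideal_def)
  moreover have "span ?C \<noteq> {0}"
  proof
    assume "span ?C = {0}"
    then have "?C = {}"
      using basis_nonzero[OF B] span_superset[of ?C] by auto
    then have "B \<subseteq> h"
      using wspace_cong[of "wt b" "\<lambda>_. 0" for b] wt_wspace B' wspace_0 by blast
    then have "UNIV \<subseteq> h"
      using span_minimal[OF _ subspace_h, of B] B' by simp
    then show False
      using br_h not_abelian by blast
  qed
  ultimately have C: "span ?C = UNIV"
    using ideal_trivial by blast
  have "B \<subseteq> ?C"
  proof
    fix b assume b: "b \<in> B"
    show "b \<in> ?C"
    proof (rule ccontr)
      assume "b \<notin> ?C"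
      then have "span ?C \<subseteq> span (B - {b})"
        by (intro span_mono) auto
      then show False
        using C b B'(1) unfolding dependent_def by blast
    qed
  qed
  moreover have "h \<subseteq> {0}"
  proof
    fix x assume "x \<in> h"
    then have "x \<in> span {b\<in>B. \<forall>x\<in>h. wt b x = 0}"
      using wspace_span[OF B, of x "\<lambda>_. 0"] wspace_0 by simp
    moreover have "{b\<in>B. \<forall>x\<in>h. wt b x = 0} = {}"
      using \<open>B \<subseteq> ?C\<close> by auto
    ultimately show "x \<in> {0}"
      by simp
  qed
  then have "?C = {}"
    using br_wt[of _ 0] B' basis_nonzero[OF B] by force
  ultimately have "UNIV = {0::'g}"
    using C by simp
  then show False
    using not_abelian by (metis UNIV_I singletonD)
qed

text \<open>The radical is an ideal, and some \<open>br e f\<close> has nonzero Killing norm, so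
  simplicity leaves only the zero ideal.\<close>

lemma killing_nondegenerate:
  assumes "\<And>y. killing x y = 0"
  shows "x = 0"
proof -
  have "{x. \<forall>y. killing x y = 0} \<noteq> UNIV"
  proof
    assume "{x. \<forall>y. killing x y = 0} = UNIV"
    then have zero: "killing x y = 0" for x y
      by auto
    obtain \<alpha> e f where ef: "e \<in> wspace \<alpha>" "f \<in> wspace (neg \<alpha>)" "br e f \<noteq> 0"
      using br_e_f_not_all_zero by blast
    then show False
      using killing_br_e_f[OF ef] br_e_f_nonzero[OF ef] zero by auto
  qed
  then show ?thesis
    using ideal_trivial[OF killing_ideal] assms by blast
qed

lemma killing_orthogonal:
  assumes "x \<in> wspace \<mu>" "y \<in> wspace \<nu>" "t \<in> h" "\<mu> t + \<nu> t \<noteq> 0"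
  shows "killing x y = 0"
proof -
  have "- (\<mu> t * killing x y) = killing (br x t) y"
    using assms br_swap[of x t] by (simp add: wspace_def killing.K_minus killing.K_scale)
  also have "\<dots> = \<nu> t * killing x y"
    unfolding killing_invariant using assms by (simp add: wspace_def killing.K_scale_right)
  finally have "(\<mu> t + \<nu> t) * killing x y = 0"
    by (metis add.right_inverse distrib_right)
  then show ?thesis
    using assms by simp
qed

lemma killing_eq_0_on_basis:
  assumes B: "weight_basis B" and "\<And>b. b \<in> B \<Longrightarrow> killing x b = 0"
  shows "x = 0"
proof (rule killing_nondegenerate)
  fix y
  have "y \<in> span B"
    using weight_basisD(2)[OF B] by simp
  then show "killing x y = 0"
    by (induction rule: span_induct_alt) (simp_all add: killing.K_add_right killing.K_scale_right assms(2))
qed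

lemma killing_nondegenerate_h:
  assumes t: "t \<in> h" and zero: "\<And>x. x \<in> h \<Longrightarrow> killing t x = 0"
  shows "t = 0"
proof -
  obtain B where B: "weight_basis B"
    by (rule weight_basis_exists)
  note B' = weight_basisD[OF B]
  have "killing t b = 0" if "b \<in> B" for b
  proof (cases "\<forall>x\<in>h. wt b x = 0")
    case True
    then have "b \<in> h"
      using wspace_cong[of "wt b" "\<lambda>_. 0"] wspace_0 wt_wspace B' that by blast
    then show ?thesis
      by (rule zero)
  next
    case False
    then show ?thesis
      using killing_orthogonal[of t "\<lambda>_. 0" b "wt b"] t wspace_0 wt_wspace B' that by auto
  qed
  then show ?thesis
    using killing_eq_0_on_basis[OF B] by blast
qed

text \<open>By nondegeneracy some weight vector of the basis pairs nontrivially with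
  \<open>e\<close>, and orthogonality of weight spaces forces its weight to be the negative of
  \<open>\<alpha>\<close>.\<close>

lemma exists_dual_vector:
  assumes e: "e \<in> wspace \<alpha>" "e \<noteq> 0"
  shows "\<exists>f\<in>wspace (neg \<alpha>). killing e f = 1"
proof -
  obtain B where B: "weight_basis B"
    by (rule weight_basis_exists)
  note B' = weight_basisD[OF B]
  obtain b where b: "b \<in> B" "killing e b \<noteq> 0"
    using killing_eq_0_on_basis[OF B] e by blast
  then have "\<forall>x\<in>h. \<alpha> x + wt b x = 0"
    using killing_orthogonal[OF e(1), of b "wt b"] wt_wspace B' by blast
  then have "wspace (wt b) = wspace (neg \<alpha>)"
    by (intro wspace_cong) (metis add.inverse_unique)
  then have "b \<in> wspace (neg \<alpha>)"
    using wt_wspace B' b by blast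
  then show ?thesis
    using b subspace_scale[OF subspace_wspace]
    by (intro bexI[of _ "(1 / killing e b) *c b"]) (auto simp: killing.K_scale_right)
qed

lemma killing_br_h:
  assumes "e \<in> wspace \<alpha>" "f \<in> wspace (neg \<alpha>)" "x \<in> h"
  shows "killing (br e f) x = \<alpha> x * killing e f"
  unfolding killing_invariant br_swap[of f x] using assms
  by (simp add: wspace_def killing.K_scale_right killing.K_minus)

end

section \<open>Roots\<close>

context simple_lie_cartan
begin

lemma root_iff: "\<alpha> \<in> roots \<longleftrightarrow> \<alpha> \<in> extensional h \<and> weight \<alpha> \<and> (\<exists>x\<in>h. \<alpha> x \<noteq> 0)"
  by (auto simp: roots_def roots_in_def weight_def wspace_def)

lemma rootD:
  assumes "\<alpha> \<in> roots"
  shows "weight \<alpha>" "\<exists>x\<in>h. \<alpha> x \<noteq> 0" "\<alpha> \<in> extensional h"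
  using assms root_iff by auto

lemma restrict_weight_root: "weight \<mu> \<Longrightarrow> x \<in> h \<Longrightarrow> \<mu> x \<noteq> 0 \<Longrightarrow> restrict \<mu> h \<in> roots"
  using weight_cong[of "restrict \<mu> h" \<mu>] by (auto simp: root_iff)

lemma killing_dual_eqI:
  assumes t: "t \<in> h" and eq: "\<And>x. x \<in> h \<Longrightarrow> killing t x = \<alpha> x"
  shows "killing_dual \<alpha> = t"
  unfolding killing_dual_def
proof (rule the_equality)
  fix u assume u: "u \<in> h \<and> (\<forall>x\<in>h. killing u x = \<alpha> x)"
  then have "u - t = 0"
    using t eq subspace_diff[OF subspace_h] by (intro killing_nondegenerate_h) (auto simp: killing.K_diff)
  then show "u = t" by simp
qed (use assms in auto)

lemma killing_dual_br:
  assumes "e \<in> wspace \<alpha>" "f \<in> wspace (neg \<alpha>)" "killing e f = 1"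
  shows "killing_dual \<alpha> = br e f"
  using assms by (intro killing_dual_eqI br_e_f) (auto simp: killing_br_h)

lemma root_vector: assumes "\<alpha> \<in> roots" obtains e where "e \<in> wspace \<alpha>" "e \<noteq> 0"
  using rootD[OF assms] unfolding weight_def by blast

lemma killing_dual_h [simp]: "\<alpha> \<in> roots \<Longrightarrow> killing_dual \<alpha> \<in> h"
  and killing_dual: "\<alpha> \<in> roots \<Longrightarrow> x \<in> h \<Longrightarrow> killing (killing_dual \<alpha>) x = \<alpha> x"
proof -
  assume "\<alpha> \<in> roots"
  then obtain e f where "e \<in> wspace \<alpha>" "f \<in> wspace (neg \<alpha>)" "killing e f = 1"
    using root_vector exists_dual_vector by metis
  then show "killing_dual \<alpha> \<in> h" "x \<in> h \<Longrightarrow> killing (killing_dual \<alpha>) x = \<alpha> x"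
    using killing_dual_br br_e_f killing_br_h by auto
qed

lemma root_add: "\<alpha> \<in> roots \<Longrightarrow> x \<in> h \<Longrightarrow> y \<in> h \<Longrightarrow> \<alpha> (x + y) = \<alpha> x + \<alpha> y"
  and root_diff: "\<alpha> \<in> roots \<Longrightarrow> x \<in> h \<Longrightarrow> y \<in> h \<Longrightarrow> \<alpha> (x - y) = \<alpha> x - \<alpha> y"
  and root_scale: "\<alpha> \<in> roots \<Longrightarrow> x \<in> h \<Longrightarrow> \<alpha> (c *c x) = c * \<alpha> x"
  using subspace_h
  by (simp_all add: killing_dual[symmetric] subspace_add subspace_diff subspace_scale
      killing.K_add_right killing.K_diff killing.K_scale_right)

text \<open>The Killing norm of the dual element \<open>t\<close> is \<open>\<alpha> t\<close> by
  duality and a positive multiple \<open>r\<close> of its square by \<open>killing_br_e_f\<close>;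
  hence \<open>\<alpha> t = 1 / r\<close>.\<close>

lemma root_killing_dual_pos:
  assumes "\<alpha> \<in> roots"
  shows "\<exists>r>0. \<alpha> (killing_dual \<alpha>) = complex_of_real r"
proof -
  let ?t = "killing_dual \<alpha>"
  obtain e f where ef: "e \<in> wspace \<alpha>" "f \<in> wspace (neg \<alpha>)" "killing e f = 1"
    using root_vector[OF assms] exists_dual_vector by metis
  have t: "?t = br e f"
    using killing_dual_br ef by simp
  have nz: "?t \<noteq> 0"
    using killing_dual[OF assms] rootD[OF assms] by force
  then have nz': "\<alpha> ?t \<noteq> 0"
    using br_e_f_nonzero ef t by simp
  obtain r where r: "r > 0" "killing ?t ?t = of_real r * (\<alpha> ?t)\<^sup>2"
    using killing_br_e_f[OF ef(1,2)] nz t by auto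
  then have "\<alpha> ?t = of_real r * (\<alpha> ?t)\<^sup>2"
    using killing_dual assms by simp
  then have "\<alpha> ?t = of_real (1 / r)"
    using nz' r by (simp add: power2_eq_square field_simps)
  then show ?thesis
    using r by (intro exI[of _ "1 / r"]) simp
qed

lemma root_killing_dual_nonzero: "\<alpha> \<in> roots \<Longrightarrow> \<alpha> (killing_dual \<alpha>) \<noteq> 0"
  using root_killing_dual_pos by fastforce

lemma coroot_h [simp]: "\<alpha> \<in> roots \<Longrightarrow> coroot \<alpha> \<in> h"
  using subspace_h by (simp add: coroot_def subspace_scale)

lemma root_coroot [simp]: "\<alpha> \<in> roots \<Longrightarrow> \<alpha> (coroot \<alpha>) = 2"
  using root_killing_dual_nonzero by (simp add: coroot_def root_scale)

lemma sl2_triple: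
  assumes \<alpha>: "\<alpha> \<in> roots" and e: "e \<in> wspace \<alpha>" "e \<noteq> 0"
  shows "\<exists>f\<in>wspace (neg \<alpha>). br e f = coroot \<alpha>"
proof -
  obtain f where f: "f \<in> wspace (neg \<alpha>)" "killing e f = 1"
    using exists_dual_vector[OF e] by blast
  then have "br e f = killing_dual \<alpha>"
    using killing_dual_br e by simp
  then show ?thesis
    using f subspace_scale[OF subspace_wspace]
    by (intro bexI[of _ "(2 / \<alpha> (killing_dual \<alpha>)) *c f"]) (auto simp: coroot_def br_scale_right)
qed

lemma obtain_sl2:
  assumes "\<alpha> \<in> roots"
  obtains e f where "e \<in> wspace \<alpha>" "f \<in> wspace (neg \<alpha>)" "br e f = coroot \<alpha>" "e \<noteq> 0" "f \<noteq> 0"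
proof -
  obtain e where e: "e \<in> wspace \<alpha>" "e \<noteq> 0"
    by (rule root_vector[OF assms])
  then obtain f where f: "f \<in> wspace (neg \<alpha>)" "br e f = coroot \<alpha>"
    using sl2_triple[OF assms] by blast
  have "f \<noteq> 0"
  proof
    assume "f = 0"
    then have "coroot \<alpha> = 0"
      using f by simp
    then have "\<alpha> (coroot \<alpha>) = 0"
      using root_scale[OF assms coroot_h[OF assms], of 0] by simp
    then show False
      using assms by simp
  qed
  then show ?thesis
    using that e f by blast
qed

lemma weight_coroot_real:
  assumes "\<alpha> \<in> roots" "weight \<beta>"
  shows "\<exists>q::real. \<beta> (coroot \<alpha>) = of_real q"
proof -
  obtain e f where ef: "e \<in> wspace \<alpha>" "f \<in> wspace (neg \<alpha>)" "br e f = coroot \<alpha>"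
    using obtain_sl2[OF assms(1)] by blast
  obtain q where "\<beta> (coroot \<alpha>) = of_real q * \<alpha> (coroot \<alpha>)"
    using weight_real_multiple[OF ef(1,2) assms(2)] ef by auto
  then show ?thesis
    using assms by (intro exI[of _ "2 * q"]) simp
qed

lemma neg_weight: "\<alpha> \<in> roots \<Longrightarrow> weight (neg \<alpha>)"
  using obtain_sl2 unfolding weight_def by metis

lemma neg_root_root: "\<alpha> \<in> roots \<Longrightarrow> neg_root \<alpha> \<in> roots"
  using restrict_weight_root[OF neg_weight, of \<alpha>] rootD[of \<alpha>] by (auto simp: neg_root_def)

text \<open>
  The part of a string on one side of a gap is stable under \<open>ad e\<close> and \<open>ad f\<close>, so the values of
  the coroot on it sum to zero; but they are all larger on one side than on the other.
\<close>

lemma string_unbroken: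
  assumes \<alpha>: "\<alpha> \<in> roots" and \<beta>: "weight \<beta>" and n: "weight (shift \<beta> \<alpha> (- n))" and k: "0 \<le> k" "k \<le> n"
  shows "weight (shift \<beta> \<alpha> (- k))"
proof (rule ccontr)
  assume gap: "\<not> weight (shift \<beta> \<alpha> (- k))"
  obtain e f where ef: "e \<in> wspace \<alpha>" "f \<in> wspace (neg \<alpha>)" "br e f = coroot \<alpha>"
    using obtain_sl2[OF \<alpha>] by blast
  obtain B where B: "weight_basis B"
    by (rule weight_basis_exists)
  obtain q where q: "\<beta> (coroot \<alpha>) = of_real q"
    using weight_coroot_real[OF \<alpha> \<beta>] by blast
  let ?C = "\<lambda>J. {b \<in> B. \<exists>j\<in>J. \<forall>x\<in>h. wt b x = shift \<beta> \<alpha> j x}"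
  have sum: "(\<Sum>b\<in>?C J. Re (wt b (coroot \<alpha>))) = 0"
    if "\<And>j. j \<in> J \<Longrightarrow> weight (shift \<beta> \<alpha> (j + 1)) \<Longrightarrow> j + 1 \<in> J"
      and "\<And>j. j \<in> J \<Longrightarrow> weight (shift \<beta> \<alpha> (j - 1)) \<Longrightarrow> j - 1 \<in> J" for J
    using arg_cong[OF string_sum_wt[OF B ef(1,2) that], where f = Re] unfolding ef(3) by (simp add: Re_sum)
  have wt: "\<exists>j\<in>J. Re (wt b (coroot \<alpha>)) = q + 2 * of_int j" if "b \<in> ?C J" for b J
    using that \<alpha> q by force
  have nonempty: "?C J \<noteq> {}" if "j \<in> J" "weight (shift \<beta> \<alpha> j)" for j J
    using weight_in_basis[OF B that(2)] that(1) by blast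
  have fin: "finite (?C J)" for J
    using weight_basisD(4)[OF B] by simp
  have "k \<noteq> 0" "k \<noteq> n"
    using gap \<beta> n by auto
  \<comment> \<open>\<open>q - 2 * of_int k\<close> is the value of the coroot at the gap. The part
    above the gap forces it to be negative, the part below forces it to be positive.\<close>
  have "q - 2 * of_int k < 0"
  proof (rule ccontr)
    assume "\<not> ?thesis"
    then have "Re (wt b (coroot \<alpha>)) > 0" if "b \<in> ?C {- k<..}" for b
      using wt[OF that] by force
    moreover have "?C {- k<..} \<noteq> {}"
      using nonempty[of 0] \<beta> k \<open>k \<noteq> 0\<close> by simp
    ultimately have "(\<Sum>b\<in>?C {- k<..}. Re (wt b (coroot \<alpha>))) > 0"
      by (intro sum_pos fin)
    moreover have "(\<Sum>b\<in>?C {- k<..}. Re (wt b (coroot \<alpha>))) = 0"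
    proof (rule sum)
      show "j - 1 \<in> {- k<..}" if "j \<in> {- k<..}" "weight (shift \<beta> \<alpha> (j - 1))" for j
        using that gap by (cases "j - 1 = - k") auto
    qed auto
    ultimately show False by simp
  qed
  moreover have "q - 2 * of_int k > 0"
  proof (rule ccontr)
    assume "\<not> ?thesis"
    then have "- Re (wt b (coroot \<alpha>)) > 0" if "b \<in> ?C {..<- k}" for b
      using wt[OF that] by force
    moreover have "?C {..<- k} \<noteq> {}"
      using nonempty[of "- n"] n k \<open>k \<noteq> n\<close> by simp
    ultimately have "(\<Sum>b\<in>?C {..<- k}. - Re (wt b (coroot \<alpha>))) > 0"
      by (intro sum_pos fin)
    moreover have "(\<Sum>b\<in>?C {..<- k}. Re (wt b (coroot \<alpha>))) = 0"
    proof (rule sum)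
      show "j + 1 \<in> {..<- k}" if "j \<in> {..<- k}" "weight (shift \<beta> \<alpha> (j + 1))" for j
        using that gap by (cases "j + 1 = - k") auto
    qed auto
    ultimately show False by (simp add: sum_negf)
  qed
  ultimately show False by simp
qed

text \<open>
  Trace of \<open>ad [e, f]\<close> on the span of \<open>f\<close>, \<open>h\<close> and the root spaces of the multiples \<open>\<alpha>, 2\<alpha>, \<dots>\<close>.
\<close>

lemma positive_multiples:
  assumes \<alpha>: "\<alpha> \<in> roots"
  obtains B b where "weight_basis B" "b \<in> B"
    "\<And>c k. c \<in> B \<Longrightarrow> \<forall>x\<in>h. wt c x = of_nat k * \<alpha> x \<Longrightarrow> k = 0 \<or> k = 1 \<and> c = b"
proof -
  obtain e f where ef: "e \<in> wspace \<alpha>" "f \<in> wspace (neg \<alpha>)" "br e f = coroot \<alpha>" "f \<noteq> 0"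
    using obtain_sl2[OF \<alpha>] by blast
  let ?c = "coroot \<alpha>"
  have "f \<in> weight_vectors"
    using ef by (auto simp: weight_vectors_def)
  \<comment> \<open>Having \<open>f\<close> in the basis allows exactly this one vector of weight
    \<open>- \<alpha>\<close> to be added to \<open>?C\<close>.\<close>
  then obtain B where B: "weight_basis B" "f \<in> B"
    using weight_basis_extend[of "{f}"] ef by auto
  note B' = weight_basisD[OF B(1)]
  let ?C = "{b \<in> B. \<exists>k::nat. \<forall>x\<in>h. wt b x = of_nat k * \<alpha> x}"
  have wt_f: "wt f x = - \<alpha> x" if "x \<in> h" for x
    using wt_eq[OF ef(2,4) that] .
  have f_notin: "f \<notin> ?C"
  proof
    assume "f \<in> ?C"
    then obtain k :: nat where "of_nat k * \<alpha> ?c = - \<alpha> ?c"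
      using wt_f[OF coroot_h[OF \<alpha>]] \<alpha> by force
    then have "of_int (int k) = (of_int (-1) :: complex)"
      using \<alpha> by simp
    then show False
      unfolding of_int_eq_iff by simp
  qed
  have up: "br e b \<in> span (insert f ?C)" if "b \<in> wspace (\<lambda>x. of_nat k * \<alpha> x)" for b k
  proof -
    have "br e b \<in> wspace (\<lambda>x. of_nat (Suc k) * \<alpha> x)"
      using wspace_br[OF ef(1) that] by (simp add: algebra_simps)
    then show ?thesis
      by (rule wspace_subset_span[OF B(1)]) blast
  qed
  have C_wspace: "\<exists>k::nat. b \<in> wspace (\<lambda>x. of_nat k * \<alpha> x)" if b: "b \<in> ?C" for b
  proof -
    obtain k :: nat where k: "\<forall>x\<in>h. wt b x = of_nat k * \<alpha> x"
      using b by auto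
    then have "wspace (wt b) = wspace (\<lambda>x. of_nat k * \<alpha> x)"
      by (intro wspace_cong) simp
    then show ?thesis
      using wt_wspace B' b by blast
  qed
  have "(\<Sum>b\<in>insert f ?C. wt b (br e f)) = 0"
  proof (rule stable_sum_wt)
    show "independent (insert f ?C)"
      using B'(1) by (rule independent_mono) (use B(2) in auto)
    show "insert f ?C \<subseteq> weight_vectors"
      using B' B(2) by auto
    show "br e f \<in> h"
      using ef br_e_f by blast
    fix b assume b: "b \<in> insert f ?C"
    show "br e b \<in> span (insert f ?C)"
    proof (cases "b = f")
      case True
      have "br e f \<in> wspace (\<lambda>x. of_nat 0 * \<alpha> x)"
        using br_e_f[OF ef(1,2)] wspace_0 by simp
      then show ?thesis
        unfolding True by (rule wspace_subset_span[OF B(1)]) blast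
    next
      case False
      then show ?thesis
        using b C_wspace up by blast
    qed
    show "br f b \<in> span (insert f ?C)"
    proof (cases "b = f")
      case False
      then obtain k :: nat where k: "b \<in> wspace (\<lambda>x. of_nat k * \<alpha> x)"
        using b C_wspace by blast
      show ?thesis
      proof (cases k)
        case 0
        then have "b \<in> h"
          using k wspace_0 by simp
        then have "br f b = \<alpha> b *c f"
          using ef(2) br_swap[of f b] by (simp add: wspace_def)
        then show ?thesis
          by (simp add: span_scale span_base)
      next
        case (Suc m)
        have "br f b \<in> wspace (\<lambda>x. of_nat m * \<alpha> x)"
          using wspace_br[OF ef(2) k] Suc by (simp add: algebra_simps)
        then show ?thesis
          by (rule wspace_subset_span[OF B(1)]) blast
      qed
    qed (simp add: br_self span_zero)
  qed
  then have sum: "wt f ?c + (\<Sum>b\<in>?C. wt b ?c) = 0"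
    using B' f_notin ef by simp
  have "\<forall>b\<in>?C. \<exists>k::nat. wt b ?c = of_nat k * 2"
    using \<alpha> by force
  from bchoice[OF this] obtain k where k: "\<And>b. b \<in> ?C \<Longrightarrow> wt b ?c = of_nat (k b) * 2"
    by blast
  have "(\<Sum>b\<in>?C. wt b ?c) = of_nat (\<Sum>b\<in>?C. k b) * 2"
    unfolding of_nat_sum sum_distrib_right by (rule sum.cong[OF refl k])
  \<comment> \<open>The vector \<open>f\<close> contributes -2 and each \<open>b\<close> in
    \<open>?C\<close> contributes \<open>2 * k b\<close>, so the multiplicities add up to 1: the
    weight \<open>\<alpha>\<close> occurs once and no higher multiple occurs.\<close>
  then have "(of_nat (\<Sum>b\<in>?C. k b) :: complex) = of_nat 1"
    using sum wt_f[OF coroot_h[OF \<alpha>]] \<alpha> by simp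
  then have k1: "(\<Sum>b\<in>?C. k b) = 1"
    unfolding of_nat_eq_iff .
  obtain b where b: "b \<in> B" "\<forall>x\<in>h. wt b x = \<alpha> x"
    using weight_in_basis[OF B(1) rootD(1)[OF \<alpha>]] by blast
  have bC: "b \<in> ?C"
    using b by (simp add: exI[of _ 1])
  have k_eq: "k c = m" if "c \<in> B" "\<forall>x\<in>h. wt c x = of_nat m * \<alpha> x" for c m
  proof -
    have "(of_nat (k c) :: complex) * 2 = of_nat m * 2"
      using k[of c] that \<alpha> by auto
    then show ?thesis by simp
  qed
  have "k b = 1"
    using k_eq[of b 1] b by simp
  have "m = 0 \<or> m = 1 \<and> c = b" if c: "c \<in> B" "\<forall>x\<in>h. wt c x = of_nat m * \<alpha> x" for c m
  proof (cases "c = b")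
    case True
    then show ?thesis
      using k_eq[OF c] \<open>k b = 1\<close> by simp
  next
    case False
    have "c \<in> ?C"
      using c by blast
    then have "(\<Sum>b\<in>{b, c}. k b) \<le> (\<Sum>b\<in>?C. k b)"
      using bC B' by (intro sum_mono2) auto
    then show ?thesis
      using k1 False \<open>k b = 1\<close> k_eq[OF c] by simp
  qed
  then show ?thesis
    using that B b by blast
qed

section \<open>One-dimensional root spaces and reflected weights\<close>

lemma weight_nat_multiple:
  assumes "\<alpha> \<in> roots" "weight (\<lambda>x. of_nat k * \<alpha> x)"
  shows "k \<le> 1"
proof -
  obtain B b where B: "weight_basis B"
      "\<And>c k. c \<in> B \<Longrightarrow> \<forall>x\<in>h. wt c x = of_nat k * \<alpha> x \<Longrightarrow> k = 0 \<or> k = 1 \<and> c = b"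
    using positive_multiples[OF assms(1)] by metis
  then show ?thesis
    using weight_in_basis[OF B(1) assms(2)] B(2) by fastforce
qed

lemma root_space_dim_1:
  assumes "\<alpha> \<in> roots"
  shows "\<exists>v. wspace \<alpha> \<subseteq> span {v}"
proof -
  obtain B b where B: "weight_basis B"
      "\<And>c k. c \<in> B \<Longrightarrow> \<forall>x\<in>h. wt c x = of_nat k * \<alpha> x \<Longrightarrow> k = 0 \<or> k = 1 \<and> c = b"
    using positive_multiples[OF assms] by metis
  have "{c\<in>B. \<forall>x\<in>h. wt c x = \<alpha> x} \<subseteq> {b}"
    using B(2)[of _ 1] by auto
  then show ?thesis
    using wspace_subset_span[OF B(1), of _ \<alpha> "{b}"] by blast
qed

lemma basis_root_vector_unique:
  assumes B: "weight_basis B" and \<alpha>: "\<alpha> \<in> roots" and "b \<in> B" "c \<in> B"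
    and "b \<in> wspace \<alpha>" "c \<in> wspace \<alpha>"
  shows "b = c"
proof (rule ccontr)
  assume "b \<noteq> c"
  obtain v where "wspace \<alpha> \<subseteq> span {v}"
    using root_space_dim_1[OF \<alpha>] by blast
  then obtain k l where kl: "b = k *c v" "c = l *c v"
    using assms(5,6) unfolding span_singleton by blast
  have "k \<noteq> 0"
    using basis_nonzero[OF B assms(3)] kl by auto
  then have "c = (l / k) *c b"
    using kl by simp
  moreover have "(l / k) *c b \<in> span (B - {c})"
    using assms(3) \<open>b \<noteq> c\<close> by (intro span_scale span_base) auto
  ultimately show False
    using weight_basisD(1)[OF B] assms(4) unfolding dependent_def by auto
qed

text \<open>Pairing \<open>j\<close> with \<open>p + q - j\<close> makes all paired terms equal to
  \<open>2 * (x + p + q)\<close>.\<close>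

lemma sum_symmetric_string:
  fixes x :: complex and p q :: int
  assumes "p \<le> q" "(\<Sum>j\<in>{p..q}. x + 2 * of_int j) = 0"
  shows "x = of_int (- (p + q))"
proof -
  have "(\<Sum>j\<in>{p..q}. x + 2 * of_int j) = (\<Sum>j\<in>{p..q}. x + 2 * of_int (p + q - j))"
    by (rule sum.reindex_bij_witness[of _ "\<lambda>j. p + q - j" "\<lambda>j. p + q - j"]) auto
  then have "0 = (\<Sum>j\<in>{p..q}. (x + 2 * of_int j) + (x + 2 * of_int (p + q - j)))"
    using assms(2) unfolding sum.distrib by simp
  also have "\<dots> = (\<Sum>j\<in>{p..q}. 2 * (x + of_int (p + q)))"
    by (intro sum.cong refl) (simp add: algebra_simps)
  also have "\<dots> = of_nat (card {p..q}) * (2 * (x + of_int (p + q)))"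
    by simp
  finally have "0 = of_nat (card {p..q}) * (2 * (x + of_int (p + q)))" .
  moreover have "(of_nat (card {p..q}) :: complex) \<noteq> 0"
    using assms(1) unfolding of_nat_eq_0_iff by simp
  ultimately have "x + of_int (p + q) = 0"
    by (metis mult_eq_0_iff zero_neq_numeral)
  then show ?thesis
    by (simp add: eq_neg_iff_add_eq_0 del: minus_add_distrib of_int_add)
qed

text \<open>The assumption \<open>nz\<close> keeps the string away from the weight 0, whose space
  \<open>h\<close> may have larger dimension, so every weight of the string occurs once in the
  basis. The positions form an interval from \<open>p\<close> to \<open>q\<close> containing 0, and
  the vanishing trace gives \<open>\<beta> (coroot \<alpha>) = - (p + q)\<close>. The reflected
  weight sits at position \<open>p + q\<close>, again between \<open>p\<close> and
  \<open>q\<close>.\<close>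

lemma string_reflection_aux:
  assumes \<alpha>: "\<alpha> \<in> roots" and \<beta>: "\<beta> \<in> roots"
    and nz: "\<And>j. \<exists>x\<in>h. shift \<beta> \<alpha> j x \<noteq> 0"
  shows "\<exists>n::int. \<beta> (coroot \<alpha>) = of_int n \<and> weight (shift \<beta> \<alpha> (- n))"
proof -
  obtain e f where ef: "e \<in> wspace \<alpha>" "f \<in> wspace (neg \<alpha>)" "br e f = coroot \<alpha>"
    using obtain_sl2[OF \<alpha>] by blast
  obtain B where B: "weight_basis B"
    by (rule weight_basis_exists)
  note B' = weight_basisD[OF B]
  let ?c = "coroot \<alpha>"
  define J where "J = {j. weight (shift \<beta> \<alpha> j)}"
  define C where "C = {b \<in> B. \<exists>j\<in>J. \<forall>x\<in>h. wt b x = shift \<beta> \<alpha> j x}"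
  have sum: "(\<Sum>b\<in>C. wt b ?c) = 0"
    unfolding C_def ef(3)[symmetric] by (rule string_sum_wt[OF B ef(1,2)]) (auto simp: J_def)
  have "\<forall>j\<in>J. \<exists>b. b \<in> B \<and> (\<forall>x\<in>h. wt b x = shift \<beta> \<alpha> j x)"
    using weight_in_basis[OF B] unfolding J_def by blast
  from bchoice[OF this] obtain b where b: "\<And>j. j \<in> J \<Longrightarrow> b j \<in> B"
      "\<And>j x. j \<in> J \<Longrightarrow> x \<in> h \<Longrightarrow> wt (b j) x = shift \<beta> \<alpha> j x"
    by blast
  have "bij_betw b J C"
    unfolding bij_betw_def
  proof
    show "inj_on b J"
    proof (rule inj_onI)
      fix i j assume "i \<in> J" "j \<in> J" "b i = b j"
      then have "shift \<beta> \<alpha> i ?c = shift \<beta> \<alpha> j ?c"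
        using b(2) coroot_h[OF \<alpha>] by metis
      then show "i = j"
        using \<alpha> by simp
    qed
    have "c = b j" if c: "c \<in> B" "j \<in> J" "\<forall>x\<in>h. wt c x = shift \<beta> \<alpha> j x" for c j
    proof -
      let ?\<mu> = "restrict (shift \<beta> \<alpha> j) h"
      have "?\<mu> \<in> roots"
        using c(2) nz[of j] restrict_weight_root[of "shift \<beta> \<alpha> j"] unfolding J_def by blast
      moreover have "wspace (wt c) = wspace ?\<mu>" "wspace (wt (b j)) = wspace ?\<mu>"
        using c b by (intro wspace_cong; simp)+
      then have "c \<in> wspace ?\<mu>" "b j \<in> wspace ?\<mu>"
        using wt_wspace[of c] wt_wspace[of "b j"] c b(1)[of j] B'(3) by blast+
      ultimately show ?thesis
        using basis_root_vector_unique[OF B] c b by blast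
    qed
    then show "b ` J = C"
      using b unfolding C_def by blast
  qed
  then have "finite J"
    using B' bij_betw_finite unfolding C_def by fastforce
  have "(\<Sum>j\<in>J. wt (b j) ?c) = 0"
    using sum sum.reindex_bij_betw[OF \<open>bij_betw b J C\<close>, of "\<lambda>b. wt b ?c"] by simp
  moreover have "(\<Sum>j\<in>J. wt (b j) ?c) = (\<Sum>j\<in>J. \<beta> ?c + 2 * of_int j)"
    using b(2) \<alpha> by (intro sum.cong) (auto simp: mult.commute)
  ultimately have sum0: "(\<Sum>j\<in>J. \<beta> ?c + 2 * of_int j) = 0"
    by simp
  have "0 \<in> J"
    using rootD[OF \<beta>] by (simp add: J_def)
  define p q where "p = Min J" and "q = Max J"
  have "J \<noteq> {}"
    using \<open>0 \<in> J\<close> by blast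
  then have pq: "p \<in> J" "q \<in> J" "p \<le> 0" "0 \<le> q"
    using Min_in[of J] Max_in[of J] \<open>finite J\<close> \<open>0 \<in> J\<close> unfolding p_def q_def by simp_all
  have "J = {p..q}"
  proof
    show "J \<subseteq> {p..q}"
      using \<open>finite J\<close> by (auto simp: p_def q_def)
    show "{p..q} \<subseteq> J"
    proof
      fix k assume k: "k \<in> {p..q}"
      have "weight (shift (shift \<beta> \<alpha> q) \<alpha> (- (q - p)))"
        using pq by (simp add: J_def algebra_simps)
      then have "weight (shift (shift \<beta> \<alpha> q) \<alpha> (- (q - k)))"
        using string_unbroken[OF \<alpha>, of "shift \<beta> \<alpha> q" "q - p" "q - k"] k pq by (simp add: J_def)
      then show "k \<in> J"
        by (simp add: J_def algebra_simps)
    qed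
  qed
  then have "\<beta> ?c = of_int (- (p + q))"
    using sum_symmetric_string[of p q "\<beta> ?c"] sum0 pq by simp
  moreover have "p + q \<in> J"
    using \<open>J = {p..q}\<close> pq by simp
  ultimately show ?thesis
    by (intro exI[of _ "- (p + q)"]) (simp add: J_def add.commute)
qed

lemma root_int_multiple:
  assumes \<alpha>: "\<alpha> \<in> roots" and \<beta>: "\<beta> \<in> roots" and k: "\<And>x. x \<in> h \<Longrightarrow> \<beta> x = of_int k * \<alpha> x"
  shows "k = 1 \<or> k = - 1"
proof -
  have "k \<noteq> 0"
    using rootD(2)[OF \<beta>] k by auto
  have "weight (\<lambda>x. of_nat (nat \<bar>k\<bar>) * \<alpha> x)"
  proof (cases "k \<ge> 0")
    case True
    then show ?thesis
      using rootD(1)[OF \<beta>] weight_cong[of \<beta> "\<lambda>x. of_nat (nat \<bar>k\<bar>) * \<alpha> x"] k by simp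
  next
    case False
    then show ?thesis
      using neg_weight[OF \<beta>] weight_cong[of "neg \<beta>" "\<lambda>x. of_nat (nat \<bar>k\<bar>) * \<alpha> x"] k by simp
  qed
  then show ?thesis
    using weight_nat_multiple[OF \<alpha>] \<open>k \<noteq> 0\<close> by fastforce
qed

text \<open>If the string does pass through 0 at position \<open>j\<close>, then
  \<open>\<beta>\<close> is \<open>- j\<close> times \<open>\<alpha>\<close>, and the reflected
  weight is simply the negative of \<open>\<beta>\<close>.\<close>

lemma string_reflection:
  assumes \<alpha>: "\<alpha> \<in> roots" and \<beta>: "\<beta> \<in> roots"
  shows "\<exists>n::int. \<beta> (coroot \<alpha>) = of_int n \<and> weight (shift \<beta> \<alpha> (- n))"
proof (cases "\<forall>j. \<exists>x\<in>h. shift \<beta> \<alpha> j x \<noteq> 0")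
  case True
  then show ?thesis
    using string_reflection_aux assms by blast
next
  case False
  then obtain j where "\<forall>x\<in>h. shift \<beta> \<alpha> j x = 0"
    by blast
  then have j: "\<beta> x = of_int (- j) * \<alpha> x" if "x \<in> h" for x
    using that by (simp add: add_eq_0_iff2)
  have "shift \<beta> \<alpha> (- (- 2 * j)) x = neg \<beta> x" if "x \<in> h" for x
    using j[OF that] by simp
  then have "weight (shift \<beta> \<alpha> (- (- 2 * j)))"
    using neg_weight[OF \<beta>] weight_cong[of "shift \<beta> \<alpha> (- (- 2 * j))" "neg \<beta>"] by blast
  moreover have "\<beta> (coroot \<alpha>) = of_int (- 2 * j)"
    using j \<alpha> by simp
  ultimately show ?thesis by blast
qed

section \<open>The roots as an abstract root system\<close>

lemma inj_killing_dual: "inj_on killing_dual roots"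
proof (rule inj_onI)
  fix \<alpha> \<beta> assume "\<alpha> \<in> roots" "\<beta> \<in> roots" "killing_dual \<alpha> = killing_dual \<beta>"
  then show "\<alpha> = \<beta>"
    using killing_dual rootD(3) by (intro extensionalityI[of _ h]) metis+
qed

lemma finite_roots: "finite roots"
proof -
  obtain B where B: "weight_basis B"
    by (rule weight_basis_exists)
  have "\<alpha> \<in> (\<lambda>b. restrict (wt b) h) ` B" if \<alpha>: "\<alpha> \<in> roots" for \<alpha>
  proof -
    obtain b where "b \<in> B" "\<forall>x\<in>h. wt b x = \<alpha> x"
      using weight_in_basis[OF B] rootD[OF \<alpha>] by blast
    moreover from this have "\<alpha> = restrict (wt b) h"
      using rootD(3)[OF \<alpha>] by (intro extensionalityI[of _ h]) auto
    ultimately show ?thesis by blast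
  qed
  then show ?thesis
    using weight_basisD(4)[OF B] finite_subset[of roots] by blast
qed

text \<open>The Killing form moves the roots into \<open>h\<close>. Roots and coweights then lie in
  one space, with \<open>killing\<close> both as invariant form and as pairing.\<close>

abbreviation R :: "'g set" where
  "R \<equiv> killing_dual ` roots"

lemma shift_R:
  assumes \<alpha>: "\<alpha> \<in> roots" and \<beta>: "\<beta> \<in> roots"
    and w: "weight (shift \<beta> \<alpha> (- k))" and nz: "x \<in> h" "shift \<beta> \<alpha> (- k) x \<noteq> 0"
  shows "killing_dual \<beta> - of_int k *c killing_dual \<alpha> \<in> R"
proof -
  let ?\<gamma> = "restrict (shift \<beta> \<alpha> (- k)) h"
  have eq: "killing_dual ?\<gamma> = killing_dual \<beta> - of_int k *c killing_dual \<alpha>"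
    using \<alpha> \<beta> subspace_h
    by (intro killing_dual_eqI) (auto simp: subspace_diff subspace_scale killing.K_diff killing.K_scale killing_dual)
  show ?thesis
    unfolding eq[symmetric] by (rule imageI[OF restrict_weight_root[OF w nz]])
qed

lemma root_coroot_cart:
  assumes "\<alpha> \<in> roots" "\<beta> \<in> roots"
  shows "killing.cart (killing_dual \<beta>) (killing_dual \<alpha>) = \<beta> (coroot \<alpha>)"
proof -
  have "\<alpha> (killing_dual \<beta>) = \<beta> (killing_dual \<alpha>)"
    using assms killing_dual killing.K_sym by (metis killing_dual_h)
  then show ?thesis
    using assms by (simp add: killing.cart_def killing_dual coroot_def root_scale)
qed

lemma root_system_R: "root_system scale killing R"
proof
  show "finite R"
    using finite_roots by simp
  show "\<exists>r>0. killing a a = complex_of_real r" if "a \<in> R" for a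
    using that root_killing_dual_pos killing_dual by auto
  show "\<exists>n::int. killing.cart b a = of_int n" if "a \<in> R" "b \<in> R" for a b
  proof -
    obtain \<alpha> \<beta> where \<alpha>: "\<alpha> \<in> roots" "a = killing_dual \<alpha>" and \<beta>: "\<beta> \<in> roots" "b = killing_dual \<beta>"
      using \<open>a \<in> R\<close> \<open>b \<in> R\<close> by blast
    then show ?thesis
      using string_reflection[OF \<alpha>(1) \<beta>(1)] root_coroot_cart[OF \<alpha>(1) \<beta>(1)] by auto
  qed
  show "killing.refl a b \<in> R" if ab: "a \<in> R" "b \<in> R" for a b
  proof -
    obtain \<alpha> \<beta> where \<alpha>: "\<alpha> \<in> roots" "a = killing_dual \<alpha>" and \<beta>: "\<beta> \<in> roots" "b = killing_dual \<beta>"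
      using ab by blast
    obtain n :: int where n: "\<beta> (coroot \<alpha>) = of_int n" "weight (shift \<beta> \<alpha> (- n))"
      using string_reflection[OF \<alpha>(1) \<beta>(1)] by blast
    \<comment> \<open>A vanishing reflected functional would mean
      \<open>\<beta> = n \<alpha>\<close> on \<open>h\<close>; evaluation at the coroot gives
      \<open>n = 2 * n\<close>, so \<open>\<beta>\<close> would be 0.\<close>
    have "\<exists>x\<in>h. shift \<beta> \<alpha> (- n) x \<noteq> 0"
    proof (rule ccontr)
      assume "\<not> ?thesis"
      then have eq: "\<beta> x = of_int n * \<alpha> x" if "x \<in> h" for x
        using that by auto
      then have "of_int n = (of_int n * 2 :: complex)"
        using n(1) \<alpha>(1) by auto
      then have "n = 0"
        by simp
      then show False
        using eq rootD(2)[OF \<beta>(1)] by auto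
    qed
    then show ?thesis
      using shift_R[OF \<alpha>(1) \<beta>(1) n(2)] n(1) root_coroot_cart[OF \<alpha>(1) \<beta>(1)] \<alpha>(2) \<beta>(2)
      by (auto simp: killing.refl_def)
  qed
  show "b - of_nat k *c a \<in> R"
    if ab: "a \<in> R" "b \<in> R" "b \<noteq> a" and n: "killing.cart b a = of_nat n" and k: "k \<le> n" for a b n k
  proof -
    obtain \<alpha> \<beta> where \<alpha>: "\<alpha> \<in> roots" "a = killing_dual \<alpha>" and \<beta>: "\<beta> \<in> roots" "b = killing_dual \<beta>"
      using ab by blast
    obtain m :: int where m: "\<beta> (coroot \<alpha>) = of_int m" "weight (shift \<beta> \<alpha> (- m))"
      using string_reflection[OF \<alpha>(1) \<beta>(1)] by blast
    have "(of_int m :: complex) = of_int (int n)"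
      using m(1) n root_coroot_cart[OF \<alpha>(1) \<beta>(1)] \<alpha>(2) \<beta>(2) by simp
    then have "m = int n"
      unfolding of_int_eq_iff .
    then have w: "weight (shift \<beta> \<alpha> (- int k))"
      using string_unbroken[OF \<alpha>(1) rootD(1)[OF \<beta>(1)] m(2), of "int k"] k by simp
    \<comment> \<open>The segment meets 0 only if \<open>\<beta> = k \<alpha>\<close> on
      \<open>h\<close>; then \<open>k = 1\<close>, that is, \<open>b = a\<close>.\<close>
    have "\<exists>x\<in>h. shift \<beta> \<alpha> (- int k) x \<noteq> 0"
    proof (rule ccontr)
      assume "\<not> ?thesis"
      then have eq: "\<beta> x = of_int (int k) * \<alpha> x" if "x \<in> h" for x
        using that by auto
      then have "int k = 1"
        using root_int_multiple[OF \<alpha>(1) \<beta>(1) eq] by auto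
      then have "\<beta> = \<alpha>"
        using eq rootD(3) \<alpha>(1) \<beta>(1) by (intro extensionalityI[of _ h]) auto
      then show False
        using ab(3) \<alpha> \<beta> by simp
    qed
    then show ?thesis
      using shift_R[OF \<alpha>(1) \<beta>(1) w] \<alpha>(2) \<beta>(2) by auto
  qed
qed

end

section \<open>The Weyl group and the coweight lattice\<close>

sublocale simple_lie_cartan \<subseteq> weyl: root_system scale killing "killing_dual ` roots"
  by (rule root_system_R)

context simple_lie_cartan
begin

abbreviation refls :: "'g list \<Rightarrow> 'g \<Rightarrow> 'g" where
  "refls \<equiv> killing.refls"

text \<open>Elements of \<open>BijGroup h\<close> are extensional on \<open>h\<close>, whereas
  \<open>refls\<close> acts on the whole space.\<close>

abbreviation word :: "'g list \<Rightarrow> 'g \<Rightarrow> 'g" where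
  "word as \<equiv> restrict (refls as) h"

lemma killing_sum_left: "killing (\<Sum>i\<in>A. g i) x = (\<Sum>i\<in>A. killing (g i) x)"
  by (induction A rule: infinite_finite_induct) (simp_all add: killing.K_add)

lemma h_eq_0_roots:
  assumes t: "t \<in> h" and zero: "\<And>\<alpha>. \<alpha> \<in> roots \<Longrightarrow> \<alpha> t = 0"
  shows "t = 0"
proof (rule h_eq_0[OF t])
  fix \<mu> assume "weight \<mu>"
  then show "\<mu> t = 0"
    using zero[of "restrict \<mu> h"] restrict_weight_root[of \<mu> t] t by fastforce
qed

lemma R_h: "a \<in> R \<Longrightarrow> a \<in> h"
  by auto

lemma killing_R: "set as \<subseteq> R \<Longrightarrow> a \<in> set as \<Longrightarrow> killing a a \<noteq> 0"
  using weyl.K_nz by blast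

lemma refls_h: "set as \<subseteq> R \<Longrightarrow> x \<in> h \<Longrightarrow> refls as x \<in> h"
proof (induction as)
  case (Cons a as)
  then have "a \<in> h" "refls as x \<in> h"
    by auto
  then show ?case
    using subspace_h by (simp add: killing.refl_def subspace_diff subspace_scale)
qed simp

lemma refls_rev_cancel:
  assumes "set as \<subseteq> R"
  shows "refls (rev as) (refls as x) = x" "refls as (refls (rev as) x) = x"
  using killing.refls_rev[of as x] killing.refls_rev[of "rev as" x] killing_R[OF assms] by auto

lemma killing_refls: "set as \<subseteq> R \<Longrightarrow> killing (refls as x) (refls as y) = killing x y"
  by (rule killing.K_refls) (rule killing_R)

lemma killing_refls_rev: "set as \<subseteq> R \<Longrightarrow> killing a (refls as x) = killing (refls (rev as) a) x"
  using killing_refls[of as "refls (rev as) a" x] refls_rev_cancel(2)[of as a] by simp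

lemma reflection_eq:
  assumes "\<alpha> \<in> roots"
  shows "reflection \<alpha> = word [killing_dual \<alpha>]"
  using assms root_killing_dual_nonzero[OF assms]
  by (auto simp: reflection_def killing.refl_def killing.cart_def coroot_def killing_dual mult.commute
      intro!: restrict_ext)

lemma word_Bij:
  assumes "set as \<subseteq> R"
  shows "word as \<in> carrier (BijGroup h)"
proof -
  have "bij_betw (refls as) h h"
  proof (rule bij_betw_byWitness[of h "refls (rev as)"])
    show "\<forall>x\<in>h. refls (rev as) (refls as x) = x" "\<forall>x\<in>h. refls as (refls (rev as) x) = x"
      using assms by (simp_all add: refls_rev_cancel)
    show "refls as ` h \<subseteq> h" "refls (rev as) ` h \<subseteq> h"
      using refls_h[of as] refls_h[of "rev as"] assms by auto
  qed
  then have "bij_betw (word as) h h"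
    by (rule bij_betw_cong[THEN iffD1, rotated]) simp
  then show ?thesis
    by (simp add: BijGroup_def Bij_def)
qed

lemma word_mult:
  assumes "set as \<subseteq> R" "set bs \<subseteq> R"
  shows "word as \<otimes>\<^bsub>BijGroup h\<^esub> word bs = word (as @ bs)"
proof -
  have "word as \<otimes>\<^bsub>BijGroup h\<^esub> word bs = compose h (word as) (word bs)"
    using word_Bij[OF assms(1)] word_Bij[OF assms(2)] by (simp add: BijGroup_def)
  also have "\<dots> = word (as @ bs)"
    by (rule ext) (auto simp: compose_def killing.refls_append refls_h assms)
  finally show ?thesis .
qed

lemma word_Nil: "word [] = \<one>\<^bsub>BijGroup h\<^esub>"
  by (auto simp: BijGroup_def)

lemma word_cancel: "set as \<subseteq> R \<Longrightarrow> word (rev as @ as) = word []"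
  by (rule restrict_ext) (simp add: killing.refls_append refls_rev_cancel)

lemma word_inv:
  assumes "set as \<subseteq> R"
  shows "inv\<^bsub>BijGroup h\<^esub> (word as) = word (rev as)"
  using assms
  by (intro group.inv_equality group_BijGroup word_Bij)
    (simp_all add: word_mult word_cancel flip: word_Nil)

text \<open>Reflections are involutions, so the inverses of generators are again generators and the
  subgroup consists of words.\<close>

lemma generate_reflections:
  assumes "S \<subseteq> roots"
  shows "generate (BijGroup h) (reflection ` S) = word ` {as. set as \<subseteq> killing_dual ` S}"
proof
  have sub: "set as \<subseteq> R" if "set as \<subseteq> killing_dual ` S" for as
    using that assms by blast
  show "generate (BijGroup h) (reflection ` S) \<subseteq> word ` {as. set as \<subseteq> killing_dual ` S}"
  proof
    fix w assume "w \<in> generate (BijGroup h) (reflection ` S)"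
    then show "w \<in> word ` {as. set as \<subseteq> killing_dual ` S}"
    proof (induction rule: generate.induct)
      case one
      show ?case
        unfolding word_Nil[symmetric] by (rule imageI) simp
    next
      case (incl w)
      then obtain \<alpha> where "\<alpha> \<in> S" "w = reflection \<alpha>" by blast
      then show ?case
        using assms reflection_eq by (auto intro!: image_eqI[of _ _ "[killing_dual \<alpha>]"])
    next
      case (inv w)
      then obtain \<alpha> where \<alpha>: "\<alpha> \<in> S" "w = reflection \<alpha>" by blast
      then have "inv\<^bsub>BijGroup h\<^esub> w = word [killing_dual \<alpha>]"
        using assms reflection_eq[of \<alpha>] word_inv[of "[killing_dual \<alpha>]"] by auto
      then show ?case
        using \<alpha> by (auto intro!: image_eqI[of _ _ "[killing_dual \<alpha>]"])
    next
      case (eng w1 w2)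
      then obtain as bs where "set as \<subseteq> killing_dual ` S" "set bs \<subseteq> killing_dual ` S"
          "w1 = word as" "w2 = word bs"
        by blast
      then show ?case
        using word_mult sub by (auto intro!: image_eqI[of _ _ "as @ bs"])
    qed
  qed
  have "word as \<in> generate (BijGroup h) (reflection ` S)" if "set as \<subseteq> killing_dual ` S" for as
    using that
  proof (induction as)
    case Nil
    show ?case
      unfolding word_Nil by (rule generate.one)
  next
    case (Cons a as)
    then obtain \<alpha> where \<alpha>: "\<alpha> \<in> S" "a = killing_dual \<alpha>" by auto
    have "word (a # as) = reflection \<alpha> \<otimes>\<^bsub>BijGroup h\<^esub> word as"
      using \<alpha> assms reflection_eq word_mult[of "[a]" as] sub[of as] Cons.prems by auto
    moreover have "reflection \<alpha> \<in> generate (BijGroup h) (reflection ` S)"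
      using \<alpha> by (intro generate.incl) blast
    moreover have "word as \<in> generate (BijGroup h) (reflection ` S)"
      by (rule Cons.IH) (use Cons.prems in simp)
    ultimately show ?case
      by (metis generate.eng)
  qed
  then show "word ` {as. set as \<subseteq> killing_dual ` S} \<subseteq> generate (BijGroup h) (reflection ` S)"
    by blast
qed

lemma weyl_of_eq: "weyl_of k = word ` {as. set as \<subseteq> killing_dual ` roots_in k}"
  unfolding weyl_of_def by (rule generate_reflections) (auto simp: roots_def roots_in_def)

lemma carrier_weyl: "carrier weyl_group = word ` {as. set as \<subseteq> R}"
  by (simp add: weyl_group_def weyl_of_eq roots_def)

lemma group_weyl: "group weyl_group"
proof -
  interpret B: group "BijGroup h"
    by (rule group_BijGroup)
  have "reflection ` roots \<subseteq> carrier (BijGroup h)"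
    using reflection_eq word_Bij by fastforce
  then show ?thesis
    unfolding weyl_group_def weyl_of_def roots_def[symmetric]
    by (intro subgroup.subgroup_is_group B.generate_is_subgroup group_BijGroup)
qed

lemma weyl_mult: "set as \<subseteq> R \<Longrightarrow> set bs \<subseteq> R \<Longrightarrow> word as \<otimes>\<^bsub>weyl_group\<^esub> word bs = word (as @ bs)"
  using word_mult by (simp add: weyl_group_def)

lemma weyl_inv:
  assumes "set as \<subseteq> R"
  shows "inv\<^bsub>weyl_group\<^esub> (word as) = word (rev as)"
proof (rule group.inv_equality[OF group_weyl])
  have "\<one>\<^bsub>weyl_group\<^esub> = word []"
    by (simp add: weyl_group_def word_Nil)
  then show "word (rev as) \<otimes>\<^bsub>weyl_group\<^esub> word as = \<one>\<^bsub>weyl_group\<^esub>"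
    using assms by (simp only: weyl_mult set_rev word_cancel)
qed (use assms in \<open>auto simp: carrier_weyl\<close>)

section \<open>The real form and the coweight lattice\<close>

lemma module_real: "module (\<lambda>r::real. scale (complex_of_real r))"
  by standard (simp_all add: scale_right_distrib scale_left_distrib)

lemma root_h_real:
  assumes "x \<in> h_real"
  shows "x \<in> h \<and> (\<forall>\<alpha>\<in>roots. \<exists>r. \<alpha> x = complex_of_real r)"
  using assms unfolding h_real_def
proof (induction rule: module.span_induct_alt[OF module_real, consumes 1, case_names base step])
  case base
  then show ?case
    using subspace_h root_scale[of _ 0 0] by (auto simp: subspace_0 intro!: exI[of _ 0])
next
  case (step c x y)
  then obtain \<beta> where \<beta>: "\<beta> \<in> roots" "x = coroot \<beta>" by blast
  have "\<exists>r. \<alpha> (of_real c *c x + y) = complex_of_real r" if \<alpha>: "\<alpha> \<in> roots" for \<alpha>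
  proof -
    obtain q where q: "\<alpha> x = complex_of_real q"
      using weight_coroot_real[OF \<beta>(1) rootD(1)[OF \<alpha>]] \<beta> by blast
    obtain s where s: "\<alpha> y = complex_of_real s"
      using step \<alpha> by blast
    show ?thesis
      using step \<alpha> \<beta> q s subspace_h
      by (intro exI[of _ "c * q + s"]) (simp add: root_add root_scale subspace_scale)
  qed
  then show ?case
    using step \<beta> subspace_h by (auto intro!: subspace_add subspace_scale)
qed

text \<open>The lattice is defined through real parts; as roots are real on \<open>h_real\<close>,
  the full value is an integer.\<close>

lemma coweight_killing:
  assumes "x \<in> coweight_lattice" "a \<in> R"
  shows "\<exists>m::int. killing a x = of_int m"
proof -
  obtain \<alpha> where \<alpha>: "\<alpha> \<in> roots" "a = killing_dual \<alpha>"
    using assms by blast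
  have x: "x \<in> h_real" "Re (\<alpha> x) \<in> \<int>"
    using assms \<alpha> by (auto simp: coweight_lattice_def pairing_def)
  then obtain m where "Re (\<alpha> x) = of_int m"
    by (auto elim: Ints_cases)
  then have "\<alpha> x = of_int m"
    using root_h_real[OF x(1)] \<alpha>(1) by fastforce
  then show ?thesis
    using \<alpha> root_h_real[OF x(1)] by (auto simp: killing_dual)
qed

lemma coweight_h: "x \<in> coweight_lattice \<Longrightarrow> x \<in> h"
  using root_h_real by (auto simp: coweight_lattice_def)

lemma refl_h_real:
  assumes a: "a \<in> R" and x: "x \<in> h_real"
  shows "killing.refl a x \<in> h_real"
proof -
  obtain \<alpha> where \<alpha>: "\<alpha> \<in> roots" "a = killing_dual \<alpha>"
    using a by blast
  obtain r where r: "\<alpha> x = complex_of_real r"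
    using root_h_real[OF x] \<alpha> by blast
  have "killing.refl a x = x - of_real r *c coroot \<alpha>"
    using fun_cong[OF reflection_eq[OF \<alpha>(1)], of x] root_h_real[OF x] \<alpha> r
    by (simp add: reflection_def)
  moreover have "coroot \<alpha> \<in> h_real"
    using \<alpha> unfolding h_real_def by (intro module.span_base[OF module_real]) blast
  ultimately show ?thesis
    using x unfolding h_real_def
    by (simp add: module.span_diff[OF module_real] module.span_scale[OF module_real])
qed

text \<open>By invariance of the form the word can be moved to the root, and words permute the
  roots.\<close>

lemma refls_coweight:
  assumes as: "set as \<subseteq> R" and x: "x \<in> coweight_lattice"
  shows "refls as x \<in> coweight_lattice"
proof -
  have "refls as x \<in> h_real"
    using as x by (induction as) (auto simp: refl_h_real coweight_lattice_def)
  moreover have "pairing (refls as x) \<alpha> \<in> \<int>" if \<alpha>: "\<alpha> \<in> roots" for \<alpha>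
  proof -
    have "\<alpha> (refls as x) = killing (killing_dual \<alpha>) (refls as x)"
      using killing_dual[OF \<alpha> refls_h[OF as coweight_h[OF x]]] by simp
    also have "\<dots> = killing (refls (rev as) (killing_dual \<alpha>)) x"
      by (rule killing_refls_rev[OF as])
    finally show ?thesis
      using coweight_killing[OF x, of "refls (rev as) (killing_dual \<alpha>)"] weyl.refls_R[of "rev as"] as \<alpha>
      by (auto simp: pairing_def)
  qed
  ultimately show ?thesis
    by (simp add: coweight_lattice_def)
qed

text \<open>On an eigenvector the coordinatewise series is the scalar exponential series times a
  fixed coordinate.\<close>

lemma Theta_weight_vector:
  assumes \<tau>: "\<tau> \<in> h" and u: "u \<in> wspace \<alpha>"
  shows "Theta \<tau> u = exp (\<i> * of_real pi * \<alpha> \<tau>) *c u"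
proof -
  let ?E = "extend_basis {}" and ?c = "\<i> * of_real pi * \<alpha> \<tau>"
  have br: "br ((\<i> * complex_of_real pi) *c \<tau>) (k *c u) = (k * ?c) *c u" for k
    using \<tau> u by (simp add: br_scale_left br_scale_right wspace_def mult.commute mult.left_commute)
  have pow: "((br ((\<i> * complex_of_real pi) *c \<tau>)) ^^ n) u = (?c ^ n) *c u" for n
  proof (induction n)
    case (Suc n)
    then show ?case
      using br[of "?c ^ n"] by (simp add: mult.commute)
  qed simp
  have "(\<lambda>n. representation ?E ((?c ^ n) *c u) b / fact n) sums (exp ?c * representation ?E u b)" for b
    using sums_mult2[OF exp_converges[of ?c], of "representation ?E u b"] ext_basis
    by (simp add: representation_scale scaleR_conv_of_real field_simps)
  then have suminf: "(\<Sum>n. representation ?E ((?c ^ n) *c u) b / fact n) = exp ?c * representation ?E u b" for b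
    by (rule sums_unique[symmetric])
  have "Theta \<tau> u = (\<Sum>b\<in>?E. (exp ?c * representation ?E u b) *c b)"
    unfolding Theta_def exp_op_def pow suminf ..
  also have "\<dots> = exp ?c *c (\<Sum>b\<in>?E. representation ?E u b *c b)"
    by (simp add: scale_sum_right)
  also have "(\<Sum>b\<in>?E. representation ?E u b *c b) = u"
    using ext_basis by (intro sum_representation_eq) auto
  finally show ?thesis .
qed

lemma exp_pi_i_eq_1_iff: "exp (\<i> * of_real pi * of_int m) = 1 \<longleftrightarrow> even m"
proof -
  have "exp (\<i> * of_real pi * of_int m) = cis (pi * of_int m)"
    by (simp add: cis_conv_exp mult.assoc)
  then show ?thesis
    by (auto simp: complex_eq_iff cos_integer_2pi sin_integer_2pi cos_int_times_real sin_int_times_real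
        mult.commute elim!: evenE oddE)
qed

text \<open>The involution acts on the whole root space of \<open>\<alpha>\<close> by the sign exp(i
  pi n), where \<open>n\<close> is the integer \<open>\<alpha> \<tau>\<close>.\<close>

lemma roots_in_k_tau:
  assumes \<tau>: "\<tau> \<in> coweight_lattice"
  shows "killing_dual ` roots_in (k_tau \<tau>) = {a \<in> R. \<exists>m::int. killing a \<tau> = 2 * of_int m}"
proof -
  have "\<alpha> \<in> roots_in (k_tau \<tau>) \<longleftrightarrow> (\<exists>m::int. killing (killing_dual \<alpha>) \<tau> = 2 * of_int m)"
    if \<alpha>: "\<alpha> \<in> roots" for \<alpha>
  proof -
    obtain n :: int where n: "killing (killing_dual \<alpha>) \<tau> = of_int n"
      using coweight_killing[OF \<tau>] \<alpha> by blast
    then have n': "\<alpha> \<tau> = of_int n"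
      using \<alpha> \<tau> coweight_h killing_dual by simp
    have "\<alpha> \<in> roots_in (k_tau \<tau>) \<longleftrightarrow> (\<exists>u\<in>wspace \<alpha>. u \<noteq> 0 \<and> Theta \<tau> u = u)"
      using rootD[OF \<alpha>] by (auto simp: roots_in_def k_tau_def wspace_def)
    also have "\<dots> \<longleftrightarrow> (\<exists>u\<in>wspace \<alpha>. u \<noteq> 0 \<and> exp (\<i> * of_real pi * of_int n) *c u = 1 *c u)"
      using Theta_weight_vector[OF coweight_h[OF \<tau>], of _ \<alpha>] n' by auto
    also have "\<dots> \<longleftrightarrow> even n"
      using rootD(1)[OF \<alpha>] exp_pi_i_eq_1_iff[of n] unfolding weight_def scale_cancel_right by blast
    also have "\<dots> \<longleftrightarrow> (\<exists>m. n = 2 * m)"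
      by (auto elim: evenE)
    also have "\<dots> \<longleftrightarrow> (\<exists>m::int. (of_int n :: complex) = 2 * of_int m)"
      by (metis of_int_eq_iff of_int_mult of_int_numeral)
    finally show ?thesis
      using n by simp
  qed
  moreover have "roots_in (k_tau \<tau>) \<subseteq> roots"
    by (auto simp: roots_def roots_in_def)
  ultimately show ?thesis by blast
qed

end

section \<open>The bijection\<close>

sublocale simple_lie_algebra_setup \<subseteq> simple_lie_cartan scale br h
  by standard (rule finite_dim simple cartan)+

context simple_lie_algebra_setup
begin

section \<open>The height function of the given simple system\<close>

lemma simples_roots: "simples \<subseteq> roots"
  and finite_simples: "finite simples"
  and simples_independent:
    "\<And>c \<beta>. (\<And>x. x \<in> h \<Longrightarrow> (\<Sum>\<beta>\<in>simples. c \<beta> * \<beta> x) = 0) \<Longrightarrow> \<beta> \<in> simples \<Longrightarrow> c \<beta> = 0"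
  and pos_or_neg: "\<alpha> \<in> roots \<Longrightarrow> nonneg_comb simples \<alpha> \<or> nonneg_comb simples (neg_root \<alpha>)"
  using simple_system unfolding simple_system_def by blast+

lemma inj_simples: "inj_on killing_dual simples"
  using inj_killing_dual simples_roots by (rule inj_on_subset)

lemma independent_killing_dual_simples: "independent (killing_dual ` simples)"
proof (rule independent_if_scalars_zero)
  show "finite (killing_dual ` simples)"
    using finite_simples by simp
  fix c a assume sum: "(\<Sum>a\<in>killing_dual ` simples. c a *c a) = 0" and a: "a \<in> killing_dual ` simples"
  then have sum': "(\<Sum>\<beta>\<in>simples. c (killing_dual \<beta>) *c killing_dual \<beta>) = 0"
    by (simp add: sum.reindex[OF inj_simples])
  have "(\<Sum>\<beta>\<in>simples. c (killing_dual \<beta>) * \<beta> x) = 0" if "x \<in> h" for x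
  proof -
    have "(\<Sum>\<beta>\<in>simples. c (killing_dual \<beta>) * \<beta> x)
        = killing (\<Sum>\<beta>\<in>simples. c (killing_dual \<beta>) *c killing_dual \<beta>) x"
      using simples_roots that
      by (auto simp: killing_sum_left killing.K_scale killing_dual intro!: sum.cong)
    then show ?thesis
      by (simp add: sum')
  qed
  from simples_independent[OF this] show "c a = 0"
    using a by blast
qed

text \<open>The usual height of a root, the sum of its coordinates in the simple roots. A basis
  extending the simple roots makes it a functional on the whole space, and the real part makes it
  real valued.\<close>

definition ht :: "'g \<Rightarrow> real" where
  "ht x = Re (\<Sum>a\<in>killing_dual ` simples. representation (extend_basis (killing_dual ` simples)) x a)"

lemma real_linear_ht: "real_linear scale ht"
  unfolding real_linear_def ht_def
  using independent_extend_basis[OF independent_killing_dual_simples]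
    span_extend_basis[OF independent_killing_dual_simples]
  by (auto simp: representation_add representation_scale sum.distrib simp flip: sum_distrib_left)

lemma ht_add: "ht (x + y) = ht x + ht y"
  and ht_scale: "ht (of_real r *c x) = r * ht x"
  using real_linear_ht by (auto simp: real_linear_def)

lemma ht_minus: "ht (- x) = - ht x"
  using ht_scale[of "-1" x] by simp

lemma ht_0: "ht 0 = 0"
  using ht_scale[of 0 0] by simp

lemma ht_sum: "finite A \<Longrightarrow> ht (\<Sum>i\<in>A. g i) = (\<Sum>i\<in>A. ht (g i))"
  by (induction A rule: finite_induct) (simp_all add: ht_add ht_0)

lemma ht_simple:
  assumes "\<beta> \<in> simples"
  shows "ht (killing_dual \<beta>) = 1"
proof -
  let ?S = "killing_dual ` simples"
  have "killing_dual \<beta> \<in> extend_basis ?S"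
    using extend_basis_superset[OF independent_killing_dual_simples] assms by blast
  then have "representation (extend_basis ?S) (killing_dual \<beta>) = (\<lambda>a. if a = killing_dual \<beta> then 1 else 0)"
    by (rule representation_basis[OF independent_extend_basis[OF independent_killing_dual_simples]])
  then show ?thesis
    using assms finite_simples by (simp add: ht_def sum.delta)
qed

text \<open>Nondegeneracy on \<open>h\<close> identifies \<open>t\<close> with the same combination
  of the dual simple roots; its height is the sum of the coefficients, which are not all
  zero.\<close>

lemma ht_nonneg_comb:
  assumes t: "t \<in> h" "t \<noteq> 0" and comb: "nonneg_comb simples \<phi>" and \<phi>: "\<And>x. x \<in> h \<Longrightarrow> killing t x = \<phi> x"
  shows "ht t > 0"
proof -
  obtain c :: "('g \<Rightarrow> complex) \<Rightarrow> nat" where c: "\<forall>x\<in>h. \<phi> x = (\<Sum>\<beta>\<in>simples. of_nat (c \<beta>) * \<beta> x)"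
    using comb unfolding nonneg_comb_def by blast
  let ?s = "\<Sum>\<beta>\<in>simples. of_nat (c \<beta>) *c killing_dual \<beta>"
  have "?s \<in> h"
    using simples_roots subspace_h by (auto intro!: subspace_sum subspace_scale)
  then have "t - ?s = 0"
    using t simples_roots subspace_h \<phi> c
    by (intro killing_nondegenerate_h)
      (auto simp: subspace_diff killing.K_diff killing_sum_left killing.K_scale killing_dual intro!: sum.cong)
  then have t_eq: "t = ?s"
    by simp
  have scale: "ht (of_nat n *c killing_dual \<beta>) = real n" if "\<beta> \<in> simples" for n \<beta>
    using ht_scale[of "real n" "killing_dual \<beta>"] ht_simple[OF that] by simp
  have ht: "ht t = (\<Sum>\<beta>\<in>simples. real (c \<beta>))"
    unfolding t_eq ht_sum[OF finite_simples] by (intro sum.cong refl scale)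
  have "\<exists>\<beta>\<in>simples. c \<beta> \<noteq> 0"
    using t t_eq by (metis (no_types, lifting) of_nat_0 scale_zero_left sum.neutral)
  then show ?thesis
    unfolding ht using finite_simples by (auto intro!: sum_pos2)
qed

lemma R_nonzero: "a \<in> R \<Longrightarrow> a \<noteq> 0"
  using weyl.K_nz killing.K_0 by metis

lemma killing_dual_neg_root:
  assumes "\<alpha> \<in> roots"
  shows "killing_dual (neg_root \<alpha>) = - killing_dual \<alpha>"
  using assms subspace_h
  by (intro killing_dual_eqI) (auto simp: subspace_neg killing.K_minus killing_dual neg_root_def)

lemma ht_pos_root: "\<alpha> \<in> pos_roots \<Longrightarrow> ht (killing_dual \<alpha>) > 0"
  using R_nonzero[of "killing_dual \<alpha>"]
  by (intro ht_nonneg_comb[of _ \<alpha>]) (auto simp: pos_roots_def killing_dual)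

lemma root_pos_or_neg: "\<alpha> \<in> roots \<Longrightarrow> \<alpha> \<in> pos_roots \<or> neg_root \<alpha> \<in> pos_roots"
  using pos_or_neg neg_root_root by (auto simp: pos_roots_def)

lemma neg_root_neg_root: "\<alpha> \<in> roots \<Longrightarrow> neg_root (neg_root \<alpha>) = \<alpha>"
  using rootD(3) by (intro extensionalityI[of _ h]) (auto simp: neg_root_def)

text \<open>The bridge from nonnegative combinations of simple roots to the language of heights. The
  converse direction holds because a root or its negative is positive.\<close>

lemma pos_roots_iff: "\<alpha> \<in> pos_roots \<longleftrightarrow> \<alpha> \<in> roots \<and> ht (killing_dual \<alpha>) > 0"
  using ht_pos_root[of \<alpha>] ht_pos_root[of "neg_root \<alpha>"] root_pos_or_neg[of \<alpha>]
    killing_dual_neg_root[of \<alpha>] ht_minus[of "killing_dual \<alpha>"]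
  by (auto simp: pos_roots_def)

lemma neg_roots_iff: "\<alpha> \<in> neg_roots \<longleftrightarrow> \<alpha> \<in> roots \<and> ht (killing_dual \<alpha>) < 0"
proof -
  have "\<alpha> \<in> neg_roots \<longleftrightarrow> \<alpha> \<in> roots \<and> neg_root \<alpha> \<in> pos_roots"
  proof
    assume "\<alpha> \<in> neg_roots"
    then obtain \<beta> where "\<beta> \<in> pos_roots" "\<alpha> = neg_root \<beta>"
      unfolding neg_roots_def by blast
    then show "\<alpha> \<in> roots \<and> neg_root \<alpha> \<in> pos_roots"
      using neg_root_neg_root neg_root_root by (simp add: pos_roots_iff)
  next
    assume "\<alpha> \<in> roots \<and> neg_root \<alpha> \<in> pos_roots"
    then show "\<alpha> \<in> neg_roots"
      using neg_root_neg_root[of \<alpha>] unfolding neg_roots_def by (intro image_eqI[of _ _ "neg_root \<alpha>"]) auto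
  qed
  then show ?thesis
    using pos_roots_iff neg_root_root killing_dual_neg_root ht_minus by auto
qed

lemma height_ht: "weyl.height ht"
  unfolding weyl.height_def
proof (intro conjI real_linear_ht ballI)
  fix a assume "a \<in> R"
  then obtain \<alpha> where \<alpha>: "\<alpha> \<in> roots" "a = killing_dual \<alpha>" by blast
  then show "ht a \<noteq> 0"
    using root_pos_or_neg[OF \<alpha>(1)] ht_pos_root[of \<alpha>] ht_pos_root[of "neg_root \<alpha>"]
      killing_dual_neg_root[OF \<alpha>(1)] ht_minus[of a] by auto
qed

sublocale ht: root_system_height scale killing "killing_dual ` roots" ht
  by standard (rule height_ht)

text \<open>
  On roots, \<open>tilt z\<close> has the sign of \<open>(\<cdot>, z)\<close>, with ties broken by \<open>ht\<close>.
\<close>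

definition tilt :: "'g \<Rightarrow> 'g \<Rightarrow> real" where
  "tilt z x = ht x + (1 + (\<Sum>a\<in>R. \<bar>ht a\<bar>)) * Re (killing x z)"

lemma real_linear_tilt: "real_linear scale (tilt z)"
  by (simp add: real_linear_def tilt_def ht_add ht_scale killing.K_add killing.K_scale algebra_simps)

lemma tilt_minus: "tilt z (- x) = - tilt z x"
  by (simp add: tilt_def ht_minus killing.K_minus)

lemma tilt_zero: "killing a z = 0 \<Longrightarrow> tilt z a = ht a"
  by (simp add: tilt_def)

text \<open>The coefficient in \<open>tilt\<close> exceeds the absolute height of every root, and a
  positive integral pairing is at least 1.\<close>

lemma tilt_pos:
  assumes a: "a \<in> R" and m: "killing a z = of_int m" "m > 0"
  shows "tilt z a > 0"
proof -
  let ?M = "1 + (\<Sum>a\<in>R. \<bar>ht a\<bar>)"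
  have "\<bar>ht a\<bar> < ?M"
    using member_le_sum[of a R "\<lambda>a. \<bar>ht a\<bar>"] a finite_roots by simp
  moreover from this have "?M * 1 \<le> ?M * of_int m"
    using m by (intro mult_left_mono) auto
  ultimately show ?thesis
    by (simp add: tilt_def m)
qed

lemma tilt_neg: "a \<in> R \<Longrightarrow> killing a z = of_int m \<Longrightarrow> m < 0 \<Longrightarrow> tilt z a < 0"
  using tilt_pos[of "- a" z "- m"] weyl.neg_R[of a] by (simp add: killing.K_minus tilt_minus)

lemma tilt_nonzero:
  assumes "a \<in> R" "killing a z = of_int m"
  shows "tilt z a \<noteq> 0"
  using tilt_pos[OF assms] tilt_neg[OF assms] tilt_zero[of a z] ht.f_nz[OF assms(1)] assms(2)
  by (cases m "0 :: int" rule: linorder_cases) auto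

section \<open>Inversion sets and the element \<open>v z\<close>\<close>

lemma N_word:
  assumes as: "set as \<subseteq> R"
  shows "N (word as) = {\<alpha> \<in> pos_roots. ht (refls (rev as) (killing_dual \<alpha>)) < 0}"
proof -
  have "act (inv\<^bsub>weyl_group\<^esub> (word as)) \<alpha> \<in> neg_roots \<longleftrightarrow> ht (refls (rev as) (killing_dual \<alpha>)) < 0"
    if \<alpha>: "\<alpha> \<in> pos_roots" for \<alpha>
  proof -
    have \<alpha>R: "\<alpha> \<in> roots"
      using \<alpha> by (simp add: pos_roots_def)
    then have "refls (rev as) (killing_dual \<alpha>) \<in> R"
      using weyl.refls_R[of "rev as"] as by simp
    then obtain \<gamma> where \<gamma>: "\<gamma> \<in> roots" "refls (rev as) (killing_dual \<alpha>) = killing_dual \<gamma>"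
      by blast
    have "act (inv\<^bsub>weyl_group\<^esub> (word as)) \<alpha> = \<gamma>"
    proof (rule extensionalityI[of _ h])
      fix x assume x: "x \<in> h"
      \<comment> \<open>The inverse in \<open>N\<close> and the one in the action on functionals
        cancel, so the word acts on \<open>x\<close> unreversed.\<close>
      have "act (inv\<^bsub>weyl_group\<^esub> (word as)) \<alpha> x = \<alpha> (refls as x)"
        using weyl_inv as weyl_inv[of "rev as"] x by (simp add: act_def)
      also have "\<dots> = killing (killing_dual \<alpha>) (refls as x)"
        using killing_dual[OF \<alpha>R] refls_h[OF as x] by simp
      also have "\<dots> = \<gamma> x"
        using killing_refls_rev[OF as] \<gamma> killing_dual[OF \<gamma>(1) x] by simp
      finally show "act (inv\<^bsub>weyl_group\<^esub> (word as)) \<alpha> x = \<gamma> x" .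
    qed (use \<gamma> rootD(3) in \<open>auto simp: act_def\<close>)
    then show ?thesis
      using \<gamma> neg_roots_iff by simp
  qed
  then show ?thesis
    by (auto simp: N_def)
qed

text \<open>For \<open>z\<close> in \<open>h\<close> this is the defining property of
  \<open>v z\<close>, stated for the element represented by \<open>as\<close> and in terms of the
  dual roots.\<close>

definition sorts :: "'g list \<Rightarrow> 'g \<Rightarrow> bool" where
  "sorts as z \<longleftrightarrow> set as \<subseteq> R \<and>
     (\<forall>a\<in>R. ht a > 0 \<longrightarrow> (ht (refls (rev as) a) < 0 \<longleftrightarrow> Re (killing a z) < 0))"

lemma N_word_iff_sorts:
  assumes "set as \<subseteq> R" "z \<in> h"
  shows "N (word as) = {\<alpha> \<in> pos_roots. pairing z \<alpha> < 0} \<longleftrightarrow> sorts as z"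
proof -
  have "N (word as) = {\<alpha> \<in> pos_roots. pairing z \<alpha> < 0} \<longleftrightarrow>
      (\<forall>\<alpha>\<in>pos_roots. ht (refls (rev as) (killing_dual \<alpha>)) < 0 \<longleftrightarrow> pairing z \<alpha> < 0)"
    unfolding N_word[OF assms(1)] by blast
  also have "\<dots> \<longleftrightarrow> sorts as z"
    using assms by (auto simp: sorts_def pos_roots_iff pairing_def killing_dual)
  finally show ?thesis .
qed

text \<open>A word carrying the system of \<open>ht\<close> to that of \<open>tilt z\<close> has an
  inverse that makes a positive root negative exactly when \<open>tilt z\<close> is negative on it.
  As ties are broken by \<open>ht\<close>, this happens exactly for a negative pairing.\<close>

lemma exists_sorts:
  assumes z: "z \<in> coweight_lattice"
  shows "\<exists>as. sorts as z"
proof -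
  have "weyl.height (tilt z)"
    unfolding weyl.height_def
  proof (intro conjI real_linear_tilt ballI)
    show "tilt z a \<noteq> 0" if "a \<in> R" for a
      using coweight_killing[OF z that] tilt_nonzero[OF that] by auto
  qed
  from weyl.exists_refls_pos[OF height_ht this]
  obtain as where as: "set as \<subseteq> R" "\<And>a. a \<in> R \<Longrightarrow> ht a > 0 \<Longrightarrow> tilt z (refls as a) > 0"
    by blast
  have "ht (refls (rev as) a) < 0 \<longleftrightarrow> Re (killing a z) < 0" if a: "a \<in> R" "ht a > 0" for a
  proof -
    let ?b = "refls (rev as) a"
    have b: "?b \<in> R" "- ?b \<in> R" "refls as ?b = a" "refls as (- ?b) = - a"
      using weyl.refls_R[of "rev as" a] weyl.neg_R as a
      by (simp_all add: refls_rev_cancel killing.refls_minus)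
    obtain m :: int where m: "killing a z = of_int m"
      using coweight_killing[OF z a(1)] by blast
    have pos: "tilt z a > 0" if "ht ?b > 0"
      using as(2)[OF b(1) that] b(3) by simp
    have neg: "tilt z a < 0" if "ht ?b < 0"
      using as(2)[OF b(2)] that b(4) tilt_minus[of z a] ht_minus[of ?b] by simp
    have "ht ?b < 0 \<longleftrightarrow> tilt z a < 0"
      using pos neg ht.f_nz[OF b(1)] by (cases "ht ?b" "0 :: real" rule: linorder_cases) auto
    also have "\<dots> \<longleftrightarrow> m < 0"
      using tilt_pos[OF a(1) m] tilt_neg[OF a(1) m] tilt_zero[of a z] m a(2)
      by (cases m "0 :: int" rule: linorder_cases) auto
    finally show ?thesis
      using m by simp
  qed
  then show ?thesis
    using as(1) by (auto simp: sorts_def)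
qed

text \<open>Two elements with the same inversion set differ by one that preserves the positive
  roots, and such an element is the identity.\<close>

lemma sorts_unique:
  assumes as: "sorts as z" and bs: "sorts bs z"
  shows "refls as x = refls bs x"
proof -
  have sub: "set as \<subseteq> R" "set bs \<subseteq> R" "set (rev as @ bs) \<subseteq> R"
    using as bs by (auto simp: sorts_def)
  have "refls (rev as @ bs) x = x"
  proof (rule ht.refls_pos_imp_id[OF sub(3)])
    fix b assume b: "b \<in> R" "ht b > 0"
    let ?a = "refls bs b"
    have a: "?a \<in> R" "- ?a \<in> R" "refls (rev bs) ?a = b" "refls (rev as) ?a \<in> R"
      using weyl.refls_R b sub weyl.neg_R by (simp_all add: refls_rev_cancel)
    have iff: "ht (refls (rev as) c) < 0 \<longleftrightarrow> ht (refls (rev bs) c) < 0" if "c \<in> R" "ht c > 0" for c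
      using as bs that by (auto simp: sorts_def)
    show "ht (refls (rev as @ bs) b) > 0"
      using iff[OF a(1)] iff[OF a(2)] a b ht.f_nz[OF a(1)] ht.f_nz[OF a(4)] ht_minus
      by (cases "ht ?a > 0") (auto simp: killing.refls_append killing.refls_minus)
  qed
  then show ?thesis
    using refls_rev_cancel(2)[OF sub(1), of "refls bs x"] by (simp add: killing.refls_append)
qed

lemma v_eq:
  assumes z: "z \<in> h" and as: "sorts as z"
  shows "v z = word as"
  unfolding v_def
proof (rule the_equality)
  have sub: "set as \<subseteq> R"
    using as by (simp add: sorts_def)
  then show "word as \<in> carrier weyl_group \<and> N (word as) = {\<alpha> \<in> pos_roots. pairing z \<alpha> < 0}"
    using carrier_weyl N_word_iff_sorts z as by auto
  fix w assume w: "w \<in> carrier weyl_group \<and> N w = {\<alpha> \<in> pos_roots. pairing z \<alpha> < 0}"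
  then obtain bs where bs: "set bs \<subseteq> R" "w = word bs"
    using carrier_weyl by auto
  then have "sorts bs z"
    using w N_word_iff_sorts z by simp
  then show "w = word as"
    using sorts_unique[OF _ as] bs by (auto intro: restrict_ext)
qed

lemma dominant_rep_eq:
  assumes "z \<in> h" "sorts as z"
  shows "dominant_rep z = refls (rev as) z"
  using assms by (simp add: dominant_rep_def v_eq weyl_inv sorts_def)

lemma Z_ab_iff:
  "z \<in> Z_ab \<longleftrightarrow> z \<in> coweight_lattice \<and> (\<forall>a\<in>R. ht a > 0 \<longrightarrow> Re (killing a z) \<in> {0, -1, 1, -2})"
  using coweight_h by (auto simp: Z_ab_def pos_roots_iff pairing_def killing_dual)

lemma finite_Z_ab: "finite Z_ab"
proof -
  \<comment> \<open>The value 2 is included because negative roots are evaluated as well.\<close>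
  let ?V = "complex_of_int ` {-2..2}"
  let ?F = "\<lambda>z. restrict (\<lambda>\<alpha>. \<alpha> z) roots"
  have "?F ` Z_ab \<subseteq> roots \<rightarrow>\<^sub>E ?V"
  proof
    fix u assume "u \<in> ?F ` Z_ab"
    then obtain z where z: "z \<in> Z_ab" "u = ?F z" by blast
    have "\<alpha> z \<in> ?V" if \<alpha>: "\<alpha> \<in> roots" for \<alpha>
    proof -
      let ?a = "killing_dual \<alpha>"
      have zl: "z \<in> coweight_lattice"
        using z by (simp add: Z_ab_iff)
      obtain m :: int where m: "killing ?a z = of_int m"
        using coweight_killing[OF zl] \<alpha> by blast
      have pos: "ht ?a > 0 \<Longrightarrow> real_of_int m \<in> {0, -1, 1, -2}"
        using z(1) \<alpha> m unfolding Z_ab_iff by (metis Re_complex_of_real imageI of_real_of_int_eq)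
      have neg: "ht (- ?a) > 0 \<Longrightarrow> - real_of_int m \<in> {0, -1, 1, -2}"
      proof -
        assume "ht (- ?a) > 0"
        then have "Re (killing (- ?a) z) \<in> {0, -1, 1, -2}"
          using z(1) weyl.neg_R[of ?a] \<alpha> unfolding Z_ab_iff by blast
        then show ?thesis
          by (simp add: killing.K_minus m)
      qed
      have "ht ?a > 0 \<or> ht (- ?a) > 0"
        using ht.f_nz[of ?a] \<alpha> ht_minus[of ?a] by auto
      then have "m \<in> {-2..2}"
        using pos neg by auto
      then show ?thesis
        using m killing_dual[OF \<alpha> coweight_h[OF zl]] by auto
    qed
    then show "u \<in> roots \<rightarrow>\<^sub>E ?V"
      using z by auto
  qed
  moreover have "finite (roots \<rightarrow>\<^sub>E ?V)"
    by (rule finite_PiE) (simp_all add: finite_roots)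
  moreover have "inj_on ?F Z_ab"
  proof (rule inj_onI)
    fix y z assume yz: "y \<in> Z_ab" "z \<in> Z_ab" "?F y = ?F z"
    then have h: "y \<in> h" "z \<in> h"
      using coweight_h by (auto simp: Z_ab_iff)
    have eq: "\<alpha> y = \<alpha> z" if "\<alpha> \<in> roots" for \<alpha>
      using fun_cong[OF yz(3), of \<alpha>] that by simp
    have "y - z = 0"
    proof (rule h_eq_0_roots)
      show "y - z \<in> h"
        using h subspace_h by (simp add: subspace_diff)
      show "\<alpha> (y - z) = 0" if "\<alpha> \<in> roots" for \<alpha>
        using eq that h by (simp add: root_diff)
    qed
    then show "y = z" by simp
  qed
  ultimately show ?thesis
    by (metis finite_imageD finite_subset)
qed

end

section \<open>Admissible words and the cosets of \<open>W_tau \<tau>\<close>\<close>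

locale simple_lie_algebra_tau = simple_lie_algebra_setup scale br h simples \<theta>
  for scale :: "complex \<Rightarrow> 'g::ab_group_add \<Rightarrow> 'g"  (infixr \<open>*c\<close> 75)
  and br :: "'g \<Rightarrow> 'g \<Rightarrow> 'g"
  and h :: "'g set"
  and simples :: "('g \<Rightarrow> complex) set"
  and \<theta> :: "'g \<Rightarrow> complex" +
  fixes \<tau> :: 'g
  assumes \<tau>_X: "\<tau> \<in> X"
begin

lemma \<tau>_lattice: "\<tau> \<in> coweight_lattice" and \<tau>_h: "\<tau> \<in> h"
  using \<tau>_X coweight_h by (auto simp: X_def)

text \<open>By \<open>roots_in_k_tau\<close> these are the duals of the roots of
  \<open>k_tau \<tau>\<close>; words in them represent \<open>W_tau \<tau>\<close>.\<close>

definition R\<tau> :: "'g set" where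
  "R\<tau> = {a \<in> R. \<exists>m::int. killing a \<tau> = 2 * of_int m}"

sublocale even: root_system scale killing R\<tau>
  unfolding R\<tau>_def by (rule weyl.root_system_even) (rule coweight_killing[OF \<tau>_lattice])

lemma R\<tau>_R: "R\<tau> \<subseteq> R"
  by (auto simp: R\<tau>_def)

lemma W_tau_eq: "W_tau \<tau> = word ` {us. set us \<subseteq> R\<tau>}"
  by (simp add: W_tau_def weyl_of_eq roots_in_k_tau[OF \<tau>_lattice] R\<tau>_def)

lemma pairing_nonneg_comb:
  assumes "nonneg_comb simples \<phi>"
  shows "Re (\<phi> \<tau>) \<ge> 0"
proof -
  obtain c :: "('g \<Rightarrow> complex) \<Rightarrow> nat" where "\<phi> \<tau> = (\<Sum>\<beta>\<in>simples. of_nat (c \<beta>) * \<beta> \<tau>)"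
    using assms \<tau>_h unfolding nonneg_comb_def by blast
  moreover have "Re (of_nat (c \<beta>) * \<beta> \<tau>) \<ge> 0" if "\<beta> \<in> simples" for \<beta>
    using \<tau>_X that by (simp add: X_def pairing_def)
  ultimately show ?thesis
    by (simp add: Re_sum sum_nonneg)
qed

text \<open>\<open>\<theta>\<close> exceeds each root by a nonnegative combination of simple roots,
  on which the dominant \<open>\<tau>\<close> is nonnegative; the lower bound follows by passing to
  the negative root.\<close>

lemma killing_\<tau>_bounds:
  assumes a: "a \<in> R" and m: "killing a \<tau> = of_int m"
  shows "\<bar>m\<bar> \<le> 2" and "ht a > 0 \<Longrightarrow> m \<ge> 0" and "ht a < 0 \<Longrightarrow> m \<le> 0"
proof -
  have le2: "Re (killing b \<tau>) \<le> 2" if b: "b \<in> R" for b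
  proof -
    obtain \<beta> where \<beta>: "\<beta> \<in> roots" "b = killing_dual \<beta>"
      using b by blast
    then have "Re (\<theta> \<tau> - \<beta> \<tau>) \<ge> 0"
      using highest_root pairing_nonneg_comb[of "\<lambda>x. \<theta> x - \<beta> x"] by (simp add: highest_root_def)
    then show ?thesis
      using \<tau>_X \<beta> \<tau>_h by (simp add: X_def pairing_def killing_dual)
  qed
  show "\<bar>m\<bar> \<le> 2"
    using le2[OF a] le2[OF weyl.neg_R[OF a]] m by (simp add: killing.K_minus)
  have pos: "Re (killing b \<tau>) \<ge> 0" if b: "b \<in> R" "ht b > 0" for b
  proof -
    obtain \<beta> where \<beta>: "\<beta> \<in> roots" "b = killing_dual \<beta>"
      using b by blast
    then have "\<beta> \<in> pos_roots"
      using b pos_roots_iff by simp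
    then show ?thesis
      using pairing_nonneg_comb[of \<beta>] \<beta> \<tau>_h by (simp add: pos_roots_def killing_dual)
  qed
  show "ht a > 0 \<Longrightarrow> m \<ge> 0"
    using pos[OF a] m by simp
  show "ht a < 0 \<Longrightarrow> m \<le> 0"
    using pos[OF weyl.neg_R[OF a]] m by (simp add: ht_minus killing.K_minus)
qed

text \<open>
  The roots in \<open>R\<tau>\<close> that are positive for this height are the positive roots orthogonal to \<open>\<tau>\<close>
  and the roots with value \<open>-2\<close> on \<open>\<tau>\<close>.
\<close>

abbreviation tht :: "'g \<Rightarrow> real" where
  "tht \<equiv> tilt (- \<tau>)"

lemma height_tht: "even.height tht"
  unfolding even.height_def
proof (intro conjI real_linear_tilt ballI)
  fix a assume "a \<in> R\<tau>"
  then have a: "a \<in> R"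
    using R\<tau>_R by blast
  obtain m :: int where m: "killing a \<tau> = of_int m"
    using coweight_killing[OF \<tau>_lattice a] by blast
  then show "tht a \<noteq> 0"
    using tilt_nonzero[OF a, of "- \<tau>" "- m"] by (simp add: killing.K_minus)
qed

sublocale even: root_system_height scale killing R\<tau> tht
  by standard (rule height_tht)

text \<open>An even value of absolute value at most 2 is -2, 0 or 2, and \<open>tht\<close> has the
  opposite sign, with ties at 0 broken by \<open>ht\<close>.\<close>

lemma tht_pos_iff:
  assumes a: "a \<in> R\<tau>" and m: "killing a \<tau> = of_int m"
  shows "tht a > 0 \<longleftrightarrow> m = - 2 \<or> m = 0 \<and> ht a > 0"
proof -
  have aR: "a \<in> R"
    using a R\<tau>_R by blast
  obtain k :: int where "killing a \<tau> = 2 * of_int k"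
    using a by (auto simp: R\<tau>_def)
  then have "(of_int m :: complex) = of_int (2 * k)"
    using m by simp
  then have "m = 2 * k"
    unfolding of_int_eq_iff .
  have km: "killing a (- \<tau>) = of_int (- m)"
    using m by (simp add: killing.K_minus)
  show ?thesis
    using tilt_pos[OF aR km] tilt_neg[OF aR km] tilt_zero[of a "- \<tau>"] km
      killing_\<tau>_bounds(1)[OF aR m] \<open>m = 2 * k\<close>
    by (cases m "0 :: int" rule: linorder_cases) auto
qed

definition admissible :: "'g list \<Rightarrow> bool" where
  "admissible as \<longleftrightarrow> set as \<subseteq> R \<and> (\<forall>a\<in>R\<tau>. tht a > 0 \<longrightarrow> ht (refls as a) > 0)"

text \<open>If a root \<open>a\<close> positive for \<open>tht\<close> went to a negative root, then
  \<open>b = - refls as a\<close> would be positive. For the value -2 of \<open>a\<close> on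
  \<open>\<tau>\<close>, \<open>b\<close> would have the forbidden value 2 on \<open>z\<close>; for
  the value 0, \<open>b\<close> would be an inversion of \<open>v z\<close> although it is
  orthogonal to \<open>z\<close>.\<close>

lemma Z_tau_admissible:
  assumes z: "z \<in> Z_tau \<tau>"
  shows "\<exists>as. admissible as \<and> v z = word as \<and> z = refls as \<tau>"
proof -
  have z_ab: "z \<in> Z_ab" and z_dom: "dominant_rep z = \<tau>"
    using z by (auto simp: Z_tau_def)
  have zl: "z \<in> coweight_lattice" and zh: "z \<in> h"
    using z_ab coweight_h by (auto simp: Z_ab_iff)
  obtain as where as: "sorts as z"
    using exists_sorts[OF zl] by blast
  have sub: "set as \<subseteq> R"
    using as by (simp add: sorts_def)
  have "refls (rev as) z = \<tau>"
    using dominant_rep_eq[OF zh as] z_dom by simp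
  then have z_eq: "z = refls as \<tau>"
    using refls_rev_cancel(2)[OF sub, of z] by simp
  have "ht (refls as a) > 0" if a: "a \<in> R\<tau>" "tht a > 0" for a
  proof (rule ccontr)
    assume "\<not> ?thesis"
    let ?b = "- refls as a"
    have aR: "a \<in> R"
      using a R\<tau>_R by blast
    have b: "?b \<in> R" "refls as a \<in> R"
      using weyl.refls_R[OF sub aR] weyl.neg_R by auto
    then have b_pos: "ht ?b > 0"
      using \<open>\<not> ht (refls as a) > 0\<close> ht.f_nz[OF b(2)] by (simp add: ht_minus)
    obtain m :: int where m: "killing a \<tau> = of_int m"
      using coweight_killing[OF \<tau>_lattice aR] by blast
    have kb: "killing ?b z = of_int (- m)"
      by (simp add: killing.K_minus z_eq killing_refls[OF sub] m)
    have "Re (killing ?b z) \<in> {0, -1, 1, -2}"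
      using z_ab b b_pos unfolding Z_ab_iff by blast
    then have "m \<noteq> - 2"
      unfolding kb by auto
    then have "m = 0" "ht a > 0"
      using tht_pos_iff[OF a(1) m] a(2) by auto
    have "ht (refls (rev as) ?b) < 0"
      using \<open>ht a > 0\<close> refls_rev_cancel(1)[OF sub, of a] by (simp add: killing.refls_minus ht_minus)
    then have "Re (killing ?b z) < 0"
      using as b b_pos unfolding sorts_def by blast
    then show False
      unfolding kb using \<open>m = 0\<close> by simp
  qed
  then show ?thesis
    using sub v_eq[OF zh as] z_eq by (auto simp: admissible_def)
qed

text \<open>A positive root \<open>b\<close> takes on the new element the value of
  \<open>a = refls (rev as) b\<close> on \<open>\<tau>\<close>. The value 2 is impossible, since
  \<open>- a\<close> would then be positive for \<open>tht\<close> but be sent to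
  \<open>- b\<close>. The same argument makes \<open>a\<close> positive when the value is 0, and for
  the remaining values dominance of \<open>\<tau>\<close> decides its sign.\<close>

lemma admissible_Z_tau:
  assumes as: "admissible as"
  shows "refls as \<tau> \<in> Z_tau \<tau> \<and> v (refls as \<tau>) = word as"
proof -
  let ?z = "refls as \<tau>"
  have sub: "set as \<subseteq> R"
    using as by (simp add: admissible_def)
  have zl: "?z \<in> coweight_lattice"
    using refls_coweight[OF sub \<tau>_lattice] .
  have zh: "?z \<in> h"
    using coweight_h[OF zl] .
  have *: "Re (killing b ?z) \<in> {0, -1, 1, -2} \<and> (ht (refls (rev as) b) < 0 \<longleftrightarrow> Re (killing b ?z) < 0)"
    if b: "b \<in> R" "ht b > 0" for b
  proof -
    let ?a = "refls (rev as) b"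
    have a: "?a \<in> R" "- ?a \<in> R" "refls as ?a = b" "refls as (- ?a) = - b"
      using weyl.refls_R[of "rev as" b] weyl.neg_R sub b
      by (simp_all add: refls_rev_cancel killing.refls_minus)
    obtain m :: int where m: "killing ?a \<tau> = of_int m"
      using coweight_killing[OF \<tau>_lattice a(1)] by blast
    have m': "killing (- ?a) \<tau> = of_int (- m)"
      using m by (simp add: killing.K_minus)
    have kb: "killing b ?z = of_int m"
      using killing_refls_rev[OF sub, of b \<tau>] m by simp
    have nonpos: "\<not> tht (- ?a) > 0" if "even m"
    proof
      assume "tht (- ?a) > 0"
      moreover have "- ?a \<in> R\<tau>"
        using that a m' unfolding R\<tau>_def by (auto elim!: evenE intro!: exI[of _ "- (m div 2)"])
      ultimately have "ht (- b) > 0"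
        using as a by (auto simp: admissible_def)
      then show False
        using b by (simp add: ht_minus)
    qed
    have "m \<noteq> 2"
    proof
      assume "m = 2"
      then show False
        using nonpos tilt_pos[OF a(2), of "- \<tau>" 2] m by (simp add: killing.K_minus)
    qed
    then have "m \<in> {0, -1, 1, -2}"
      using killing_\<tau>_bounds(1)[OF a(1) m] by auto
    moreover have "ht ?a < 0 \<longleftrightarrow> m < 0"
    proof
      assume neg: "ht ?a < 0"
      then have "m \<noteq> 0"
        using nonpos tilt_zero[of "- ?a" "- \<tau>"] m by (auto simp: killing.K_minus ht_minus)
      then show "m < 0"
        using killing_\<tau>_bounds(3)[OF a(1) m neg] by simp
    next
      assume "m < 0"
      then show "ht ?a < 0"
        using killing_\<tau>_bounds(2)[OF a(1) m] ht.f_nz[OF a(1)] by fastforce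
    qed
    ultimately show ?thesis
      unfolding kb by auto
  qed
  have sorts: "sorts as ?z"
    using sub * by (auto simp: sorts_def)
  have "?z \<in> Z_ab"
    using zl * by (auto simp: Z_ab_iff)
  moreover have "dominant_rep ?z = \<tau>"
    using dominant_rep_eq[OF zh sorts] refls_rev_cancel(1)[OF sub] by simp
  ultimately show ?thesis
    using v_eq[OF zh sorts] by (simp add: Z_tau_def)
qed

lemma W_tau_coset:
  assumes "set as \<subseteq> R"
  shows "W_tau \<tau> #>\<^bsub>weyl_group\<^esub> word as = (\<lambda>us. word (us @ as)) ` {us. set us \<subseteq> R\<tau>}"
proof -
  have "word us \<otimes>\<^bsub>weyl_group\<^esub> word as = word (us @ as)" if "set us \<subseteq> R\<tau>" for us
    using that R\<tau>_R assms by (intro weyl_mult) auto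
  then show ?thesis
    by (auto simp: r_coset_def W_tau_eq)
qed

definition coset_of :: "'g \<Rightarrow> ('g \<Rightarrow> 'g) set" where
  "coset_of z = W_tau \<tau> #>\<^bsub>weyl_group\<^esub> inv\<^bsub>weyl_group\<^esub> (v z)"

lemma coset_of_admissible:
  assumes "admissible as"
  shows "coset_of (refls as \<tau>) = (\<lambda>us. word (us @ rev as)) ` {us. set us \<subseteq> R\<tau>}"
proof -
  have sub: "set as \<subseteq> R"
    using assms by (simp add: admissible_def)
  then show ?thesis
    using admissible_Z_tau[OF assms] weyl_inv W_tau_coset[of "rev as"] by (simp add: coset_of_def)
qed

text \<open>Equal cosets give \<open>bs = as us\<close> on \<open>h\<close> with \<open>us\<close> a
  word in \<open>R\<tau>\<close>. Since \<open>as\<close> and \<open>bs\<close> both send the system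
  of \<open>tht\<close> to positive roots, \<open>us\<close> preserves that system, hence is the
  identity.\<close>

lemma inj_coset_of: "inj_on coset_of (Z_tau \<tau>)"
proof (rule inj_onI)
  fix y z assume y: "y \<in> Z_tau \<tau>" and z: "z \<in> Z_tau \<tau>" and eq: "coset_of y = coset_of z"
  obtain as where as: "admissible as" "y = refls as \<tau>"
    using Z_tau_admissible[OF y] by blast
  obtain bs where bs: "admissible bs" "z = refls bs \<tau>"
    using Z_tau_admissible[OF z] by blast
  have sub: "set as \<subseteq> R" "set bs \<subseteq> R"
    using as bs by (auto simp: admissible_def)
  have "word ([] @ rev as) \<in> coset_of y"
    unfolding as(2) coset_of_admissible[OF as(1)] by (rule imageI) simp
  then obtain us where us: "set us \<subseteq> R\<tau>" "word (rev as) = word (us @ rev bs)"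
    unfolding eq bs(2) coset_of_admissible[OF bs(1)] by auto
  have bs_eq: "refls bs x = refls as (refls us x)" if "x \<in> h" for x
  proof -
    have "refls (rev as) (refls bs x) = refls us (refls (rev bs) (refls bs x))"
      using fun_cong[OF us(2), of "refls bs x"] refls_h[OF sub(2) that] by (simp add: killing.refls_append)
    then show ?thesis
      using refls_rev_cancel(1)[OF sub(2), of x] refls_rev_cancel(2)[OF sub(1), of "refls bs x"] by simp
  qed
  have "refls us \<tau> = \<tau>"
  proof (rule even.refls_pos_imp_id[OF us(1)])
    fix a assume a: "a \<in> R\<tau>" "tht a > 0"
    have ua: "refls us a \<in> R\<tau>" "- refls us a \<in> R\<tau>"
      using even.refls_R[OF us(1) a(1)] even.neg_R by auto
    have "ht (refls bs a) > 0"
      using bs(1) a by (simp add: admissible_def)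
    then have "ht (refls as (refls us a)) > 0"
      using bs_eq[of a] a R\<tau>_R R_h by auto
    then show "tht (refls us a) > 0"
      using as(1) ua even.f_nz[OF ua(1)] tilt_minus[of "- \<tau>" "refls us a"]
      by (force simp: admissible_def killing.refls_minus ht_minus)
  qed
  then show "y = z"
    using bs_eq[OF \<tau>_h] as bs by simp
qed

text \<open>For a representative \<open>cs\<close>, composing \<open>ht\<close> with the inverse of
  \<open>cs\<close> gives a second height on \<open>R\<tau>\<close>. Transitivity within
  \<open>W_tau \<tau>\<close> provides \<open>us\<close> aligning it with \<open>tht\<close>; then
  \<open>rev cs @ us\<close> is admissible, and its inverse differs from \<open>cs\<close> by an
  element of \<open>W_tau \<tau>\<close>.\<close>

lemma coset_of_image: "coset_of ` Z_tau \<tau> = rcosets\<^bsub>weyl_group\<^esub> (W_tau \<tau>)"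
proof
  show "coset_of ` Z_tau \<tau> \<subseteq> rcosets\<^bsub>weyl_group\<^esub> (W_tau \<tau>)"
  proof (intro image_subsetI)
    fix z assume z: "z \<in> Z_tau \<tau>"
    obtain as where as: "admissible as" "v z = word as"
      using Z_tau_admissible[OF z] by blast
    then have "inv\<^bsub>weyl_group\<^esub> (v z) \<in> carrier weyl_group"
      using weyl_inv by (auto simp: admissible_def carrier_weyl)
    then show "coset_of z \<in> rcosets\<^bsub>weyl_group\<^esub> (W_tau \<tau>)"
      by (auto simp: coset_of_def RCOSETS_def)
  qed
  show "rcosets\<^bsub>weyl_group\<^esub> (W_tau \<tau>) \<subseteq> coset_of ` Z_tau \<tau>"
  proof
    fix C assume "C \<in> rcosets\<^bsub>weyl_group\<^esub> (W_tau \<tau>)"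
    then obtain cs where cs: "set cs \<subseteq> R" "C = W_tau \<tau> #>\<^bsub>weyl_group\<^esub> word cs"
      by (auto simp: RCOSETS_def carrier_weyl)
    have "weyl.height (\<lambda>x. ht (refls (rev cs) x))"
      using cs by (intro weyl.height_refls height_ht) auto
    then have "even.height (\<lambda>x. ht (refls (rev cs) x))"
      using R\<tau>_R unfolding weyl.height_def even.height_def by blast
    then obtain us where us: "set us \<subseteq> R\<tau>"
        "\<forall>a\<in>R\<tau>. tht a > 0 \<longrightarrow> ht (refls (rev cs) (refls us a)) > 0"
      using even.exists_refls_pos[OF height_tht] by blast
    let ?as = "rev cs @ us"
    have adm: "admissible ?as"
      using us cs R\<tau>_R by (auto simp: admissible_def killing.refls_append)
    have uR: "set us \<subseteq> R"
      using us R\<tau>_R by auto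
    have "(\<lambda>ws. word (ws @ rev ?as)) ` {ws. set ws \<subseteq> R\<tau>} = (\<lambda>ws. word (ws @ cs)) ` {ws. set ws \<subseteq> R\<tau>}"
    proof (intro equalityI image_subsetI)
      fix ws assume "ws \<in> {ws. set ws \<subseteq> R\<tau>}"
      then show "word (ws @ rev ?as) \<in> (\<lambda>ws. word (ws @ cs)) ` {ws. set ws \<subseteq> R\<tau>}"
        using us by (intro image_eqI[of _ _ "ws @ rev us"]) auto
    next
      fix ws assume ws: "ws \<in> {ws. set ws \<subseteq> R\<tau>}"
      \<comment> \<open>The inserted factor \<open>us @ rev us\<close> acts as the identity.\<close>
      have "word (ws @ cs) = word ((ws @ us) @ rev ?as)"
        using refls_rev_cancel(2)[OF uR] by (intro restrict_ext) (simp add: killing.refls_append)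
      then show "word (ws @ cs) \<in> (\<lambda>ws. word (ws @ rev ?as)) ` {ws. set ws \<subseteq> R\<tau>}"
        using us ws by (intro image_eqI[of _ _ "ws @ us"]) auto
    qed
    then have "coset_of (refls ?as \<tau>) = C"
      using coset_of_admissible[OF adm] W_tau_coset[OF cs(1)] cs(2) by simp
    then show "C \<in> coset_of ` Z_tau \<tau>"
      using admissible_Z_tau[OF adm] by blast
  qed
qed

lemma bij_coset_of: "bij_betw coset_of (Z_tau \<tau>) (rcosets\<^bsub>weyl_group\<^esub> (W_tau \<tau>))"
  using inj_coset_of coset_of_image by (simp add: bij_betw_def)

lemma finite_Z_tau: "finite (Z_tau \<tau>)"
  using finite_Z_ab by (rule finite_subset[rotated]) (auto simp: Z_tau_def)

end

theorem theorem2p4: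
  fixes scale :: "complex \<Rightarrow> 'g::ab_group_add \<Rightarrow> 'g"
    and br :: "'g \<Rightarrow> 'g \<Rightarrow> 'g"
    and h :: "'g set"
    and simples :: "('g \<Rightarrow> complex) set"
    and \<theta> :: "'g \<Rightarrow> complex"
    and \<tau> :: 'g
  assumes "simple_lie_algebra_setup scale br h simples \<theta>"
    and "\<tau> \<in> simple_lie_algebra_setup.X scale br h simples \<theta>"
  shows "bij_betw
           (\<lambda>z. lie_algebra_with_cartan.W_tau scale br h \<tau>
                  #>\<^bsub>lie_algebra_with_cartan.weyl_group scale br h\<^esub>
                inv\<^bsub>lie_algebra_with_cartan.weyl_group scale br h\<^esub>
                  (simple_lie_algebra_setup.v scale br h simples z))
           (simple_lie_algebra_setup.Z_tau scale br h simples \<tau>)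
           (rcosets\<^bsub>lie_algebra_with_cartan.weyl_group scale br h\<^esub>
              (lie_algebra_with_cartan.W_tau scale br h \<tau>))
    \<and> finite (simple_lie_algebra_setup.Z_tau scale br h simples \<tau>)
    \<and> card (simple_lie_algebra_setup.Z_tau scale br h simples \<tau>)
           = lie_algebra_with_cartan.n_tau scale br h \<tau>"
proof -
  interpret simple_lie_algebra_tau scale br h simples \<theta> \<tau>
    using assms by (intro simple_lie_algebra_tau.intro simple_lie_algebra_tau_axioms.intro)
  show ?thesis
    using bij_coset_of finite_Z_tau bij_betw_same_card[OF bij_coset_of]
    unfolding coset_of_def[abs_def] n_tau_def by blast
qed

end
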